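(* Let $K$ be a field of characteristic $0$, let $r\ge0$ be an integer, and let \[ I=\big(\det V(x_{i_0},\dots,x_{i_r})\mid i_0,\dots,i_r\ge1\big)\subset K[X]=K[x_1,x_2,\dots] \] be the hook Specht ideal corresponding to $(\infty,1^r)$. Then the symmetric Hilbert series of $K[X]/I$ is the rational function \[ H^{\mathrm{Sym}}(K[X]/I;t)=\frac{1}{1-t}\sum_{k=0}^{r-1}\prod_{i=1}^k\frac{t^{2i}}{(1-t^i)(1-t^{i+1})}. \]
   Context: $V(a_0,\dots,a_r)$ is the $(r+1)\times(r+1)$ Vandermonde matrix with rows $(1,a_j,a_j^2,\dots,a_j^r)$, $j=0,\dots,r$. $K[X]=K[x_i\mid i\ge1]$ is graded by degree, $K[X_n]=K[x_1,\dots,x_n]$, and $\mathrm{Sym}(n)$ acts on $K[X_n]$ by permuting variables. For an ideal $I\subset K[X]$ that is homogeneous and stable under all finite permutations of the variables, put $I_n=I\cap K[X_n]$, let the superscript $\mathrm{Sym}$ denote $\mathrm{Sym}(n)$-invariants, and define the symmetric dimension $\mathrm{SD}(K[X]/I,d)=\lim_{n\to\infty}\dim_K\big[K[X_n]^{\mathrm{Sym}}/I_n^{\mathrm{Sym}}\big]_d$ (this limit exists and is finite) and the symmetric Hilbert series $H^{\mathrm{Sym}}(K[X]/I;t)=\sum_{d\ge0}\mathrm{SD}(K[X]/I,d)\,t^d$. Empty products equal $1$ and empty sums equal $0$. *)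

theory Defs
  imports
    "Jordan_Normal_Form.VS_Connect"
    "HOL-Library.Poly_Mapping"
    "HOL-Library.Set_Algebras"
    "HOL-Computational_Algebra.Formal_Power_Series"
begin

hide_const (open) Multiset.mult Polynomial.smult

text \<open>Polynomials in countably many variables. The index \<^term>\<open>i::nat\<close> stands for the variable
  $x_{i+1}$, so $x_1, \dots, x_n$ are the variables with index \<^term>\<open>i < n\<close>.\<close>

type_synonym 'k mpoly = "(nat \<Rightarrow>\<^sub>0 nat) \<Rightarrow>\<^sub>0 'k"

definition Var :: "nat \<Rightarrow> 'k::comm_ring_1 mpoly" where
  "Var i = Poly_Mapping.single (Poly_Mapping.single i 1) 1"

definition scale :: "'k::comm_ring_1 \<Rightarrow> 'k mpoly \<Rightarrow> 'k mpoly" where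
  "scale c p = Poly_Mapping.map ((*) c) p"

definition polys_in :: "nat \<Rightarrow> 'k::comm_ring_1 mpoly set" where
  "polys_in n = {p. \<forall>m\<in>Poly_Mapping.keys p. Poly_Mapping.keys m \<subseteq> {..<n}}"

definition homogeneous :: "nat \<Rightarrow> 'k::comm_ring_1 mpoly set" where
  "homogeneous d =
     {p. \<forall>m\<in>Poly_Mapping.keys p. (\<Sum>i\<in>Poly_Mapping.keys m. Poly_Mapping.lookup m i) = d}"

text \<open>For a permutation \<^term>\<open>\<sigma>\<close>, the substitution $x_i \mapsto x_{\sigma(i)}$: the coefficient
  of the result at an exponent vector $m$ is the coefficient of \<^term>\<open>p\<close> at $m \circ \sigma$.\<close>

definition permute_vars :: "(nat \<Rightarrow> nat) \<Rightarrow> 'k::comm_ring_1 mpoly \<Rightarrow> 'k mpoly" where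
  "permute_vars \<sigma> p = Poly_Mapping.map_key (Poly_Mapping.map_key \<sigma>) p"

definition sym_polys :: "nat \<Rightarrow> 'k::comm_ring_1 mpoly set" where
  "sym_polys n = {p \<in> polys_in n. \<forall>\<sigma>. \<sigma> permutes {..<n} \<longrightarrow> permute_vars \<sigma> p = p}"

text \<open>The image of a subspace \<^term>\<open>U\<close> in the quotient modulo a subspace \<^term>\<open>W\<close>, as a space of
  cosets. In \<open>smult\<close>, adding \<^term>\<open>W\<close> makes the product with the scalar 0 the coset
  \<^term>\<open>W\<close> and not \<^term>\<open>{0}\<close>. The ring multiplication fields of the record play no role for
  vector spaces.\<close>

definition coset_space ::
    "'k::comm_ring_1 mpoly set \<Rightarrow> 'k mpoly set \<Rightarrow> ('k, 'k mpoly set) module" where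
  "coset_space U W =
     \<lparr>carrier = (\<lambda>u. u +o W) ` U, mult = undefined, one = undefined,
      zero = W, add = (+), smult = (\<lambda>c X. scale c ` X + W)\<rparr>"

text \<open>The degree \<^term>\<open>d\<close> component of $K[X_n]^{Sym} / I_n^{Sym}$.\<close>

definition sym_quotient_component ::
    "'k::comm_ring_1 mpoly set \<Rightarrow> nat \<Rightarrow> nat \<Rightarrow> ('k, 'k mpoly set) module" where
  "sym_quotient_component I n d =
     coset_space (sym_polys n \<inter> homogeneous d) (I \<inter> sym_polys n)"

definition symmetric_dimension :: "'k::field_char_0 mpoly set \<Rightarrow> nat \<Rightarrow> nat" where
  "symmetric_dimension I d =
     lim (\<lambda>n. vectorspace.dim class_ring (sym_quotient_component I n d))"

definition symmetric_hilbert_series :: "'k::field_char_0 mpoly set \<Rightarrow> rat fps" where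
  "symmetric_hilbert_series I = Abs_fps (\<lambda>d. of_nat (symmetric_dimension I d))"

definition vandermonde :: "nat \<Rightarrow> (nat \<Rightarrow> 'a::comm_ring_1) \<Rightarrow> 'a mat" where
  "vandermonde r a = mat (r + 1) (r + 1) (\<lambda>(j, k). a j ^ k)"

text \<open>For a ring acting on itself by multiplication, the span of a set is the ideal
  it generates.\<close>

global_interpretation ideal: Modules.module "(*) :: 'a::comm_ring_1 \<Rightarrow> 'a \<Rightarrow> 'a"
  by unfold_locales (simp_all add: algebra_simps)

definition hook_specht_ideal :: "nat \<Rightarrow> 'k::comm_ring_1 mpoly set" where
  "hook_specht_ideal r = ideal.span {det (vandermonde r (\<lambda>j. Var (i j))) | i :: nat \<Rightarrow> nat. True}"

lemma permute_vars_Var: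
  assumes "bij \<sigma>"
  shows "permute_vars \<sigma> (Var i) = Var (\<sigma> i)"
proof -
  have inj: "inj \<sigma>"
    using assms by (rule bij_is_inj)
  have inj': "inj (Poly_Mapping.map_key \<sigma> :: (nat \<Rightarrow>\<^sub>0 nat) \<Rightarrow> _)"
  proof (rule injI, rule poly_mapping_eqI)
    fix x y :: "nat \<Rightarrow>\<^sub>0 nat" and k
    assume "Poly_Mapping.map_key \<sigma> x = Poly_Mapping.map_key \<sigma> y"
    then have "Poly_Mapping.lookup x (\<sigma> j) = Poly_Mapping.lookup y (\<sigma> j)" for j
      by (metis inj comp_apply map_key.rep_eq)
    then show "Poly_Mapping.lookup x k = Poly_Mapping.lookup y k"
      using assms by (metis bij_pointE)
  qed
  have "Poly_Mapping.single i (1::nat) = Poly_Mapping.map_key \<sigma> (Poly_Mapping.single (\<sigma> i) 1)"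
    using inj by simp
  then show ?thesis
    unfolding permute_vars_def Var_def using map_key_single[OF inj'] by metis
qed

lemma vectorspace_coset_space:
  fixes U W :: "'k::field mpoly set"
  assumes U: "0 \<in> U" "\<And>u v. u \<in> U \<Longrightarrow> v \<in> U \<Longrightarrow> u + v \<in> U" "\<And>c u. u \<in> U \<Longrightarrow> scale c u \<in> U"
    and W: "0 \<in> W" "\<And>u v. u \<in> W \<Longrightarrow> v \<in> W \<Longrightarrow> u + v \<in> W" "\<And>c u. u \<in> W \<Longrightarrow> scale c u \<in> W"
  shows "vectorspace class_ring (coset_space U W)"
proof -
  have scale_add: "scale c (u + v) = scale c u + scale c v" for c and u v :: "'k mpoly"
    by (simp add: scale_def mult_map_scale_conv_mult distrib_left)
  have add_scale: "scale (b + c) u = scale b u + scale c u" for b c and u :: "'k mpoly"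
    by (simp add: scale_def mult_map_scale_conv_mult single_add distrib_right)
  have scale_scale: "scale (b * c) u = scale b (scale c u)" for b c and u :: "'k mpoly"
    by (simp add: scale_def mult_map_scale_conv_mult mult_single flip: mult.assoc)
  have scale_one: "scale 1 u = u" for u :: "'k mpoly"
    by (simp add: scale_def mult_map_scale_conv_mult)
  have scale_minus: "u + scale (-1) u = 0" for u :: "'k mpoly"
    using add_scale[of 1 "-1" u]
    by (simp add: scale_one) (simp add: scale_def mult_map_scale_conv_mult)
  have coset_add: "(u +o W) + (v +o W) = (u + v) +o W" for u v
  proof
    show "(u +o W) + (v +o W) \<subseteq> (u + v) +o W"
    proof
      fix x assume "x \<in> (u +o W) + (v +o W)"
      then obtain a b where ab: "a \<in> W" "b \<in> W" "x = (u + a) + (v + b)"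
        by (auto simp: set_plus_def elt_set_plus_def)
      then have "x = (u + v) + (a + b)" by (simp add: ac_simps)
      with ab W(2) show "x \<in> (u + v) +o W" by (auto simp: elt_set_plus_def)
    qed
    show "(u + v) +o W \<subseteq> (u +o W) + (v +o W)"
    proof
      fix x assume "x \<in> (u + v) +o W"
      then obtain a where "a \<in> W" "x = (u + v) + a" by (auto simp: elt_set_plus_def)
      then have "x = (u + a) + (v + 0)" "a \<in> W" by (simp_all add: ac_simps)
      with W(1) show "x \<in> (u +o W) + (v +o W)"
        by (force simp: set_plus_def elt_set_plus_def)
    qed
  qed
  have coset_scale: "scale c ` (u +o W) + W = scale c u +o W" for c u
  proof
    show "scale c ` (u +o W) + W \<subseteq> scale c u +o W"
    proof
      fix x assume "x \<in> scale c ` (u +o W) + W"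
      then obtain a b where ab: "a \<in> W" "b \<in> W" "x = scale c (u + a) + b"
        by (auto simp: set_plus_def elt_set_plus_def)
      then have "x = scale c u + (scale c a + b)" by (simp add: scale_add ac_simps)
      with ab W(2,3) show "x \<in> scale c u +o W" by (auto simp: elt_set_plus_def)
    qed
    show "scale c u +o W \<subseteq> scale c ` (u +o W) + W"
    proof
      fix x assume "x \<in> scale c u +o W"
      then obtain a where "a \<in> W" "x = scale c (u + 0) + a" by (auto simp: elt_set_plus_def)
      with W(1) show "x \<in> scale c ` (u +o W) + W"
        unfolding set_plus_def elt_set_plus_def by blast
    qed
  qed
  have zero: "W = 0 +o W" by (simp add: elt_set_plus_def)
  show ?thesis
  proof (rule vs_criteria)
    show "field (class_ring :: 'k ring)" by (rule class_field)
    show "\<forall>v\<in>carrier (coset_space U W). \<exists>neg_v\<in>carrier (coset_space U W).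
        v \<oplus>\<^bsub>coset_space U W\<^esub> neg_v = \<zero>\<^bsub>coset_space U W\<^esub>"
    proof
      fix v assume "v \<in> carrier (coset_space U W)"
      then obtain u where u: "u \<in> U" "v = u +o W" by (auto simp: coset_space_def)
      have "v + (scale (-1) u +o W) = W"
        using zero by (simp add: u coset_add scale_minus)
      then show "\<exists>neg_v\<in>carrier (coset_space U W).
          v \<oplus>\<^bsub>coset_space U W\<^esub> neg_v = \<zero>\<^bsub>coset_space U W\<^esub>"
        using U(3)[OF u(1), of "-1"] by (auto simp: coset_space_def)
    qed
    show "\<forall>v\<in>carrier (coset_space U W).
        v \<oplus>\<^bsub>coset_space U W\<^esub> \<zero>\<^bsub>coset_space U W\<^esub> = v"
    proof
      fix v assume "v \<in> carrier (coset_space U W)"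
      then obtain u where u: "v = u +o W" by (auto simp: coset_space_def)
      have "v + W = v" using coset_add[of u 0] zero by (simp add: u)
      then show "v \<oplus>\<^bsub>coset_space U W\<^esub> \<zero>\<^bsub>coset_space U W\<^esub> = v"
        by (simp add: coset_space_def)
    qed
    show "\<zero>\<^bsub>coset_space U W\<^esub> \<in> carrier (coset_space U W)"
      using image_eqI[where f = "\<lambda>u. u +o W", OF zero U(1)] by (simp add: coset_space_def)
    show "\<forall>v w. v \<in> carrier (coset_space U W) \<and> w \<in> carrier (coset_space U W) \<longrightarrow>
        v \<oplus>\<^bsub>coset_space U W\<^esub> w = w \<oplus>\<^bsub>coset_space U W\<^esub> v"
      by (simp add: coset_space_def add.commute)
    show "\<forall>v w x. v \<in> carrier (coset_space U W) \<and> w \<in> carrier (coset_space U W) \<and>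
        x \<in> carrier (coset_space U W) \<longrightarrow>
        (v \<oplus>\<^bsub>coset_space U W\<^esub> w) \<oplus>\<^bsub>coset_space U W\<^esub> x =
        v \<oplus>\<^bsub>coset_space U W\<^esub> (w \<oplus>\<^bsub>coset_space U W\<^esub> x)"
      by (simp add: coset_space_def add.assoc)
  qed (use U in \<open>auto simp: coset_space_def coset_add coset_scale\<close>,
      simp_all add: scale_add add_scale scale_scale scale_one)
qed

end

theory Submission
  imports Defs
begin

text \<open>Both sides of the theorem count the partitions of $d$ that do not contain a rectangle with
  $r + 1$ rows and $r$ columns: classified by their Durfee rectangle, with $k + 1$ rows and $k < r$
  columns, they have the generating function $\sum_{k<r} t^{k(k+1)} / ((t)_k (t)_{k+1})$.

  Upper bound: if the parts $e_0 \ge \dots \ge e_r$ of $e$ are at least $r$, symmetrizing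
  $x^{e'} \det V(x_0, \dots, x_r)$ with $e'_i = e_i - i$ expresses the monomial symmetric polynomial
  of $e$ modulo $I$ by those of exponents with a larger sum of squares, so the partitions without
  the rectangle span the quotient.

  Lower bound: to a partition with Durfee rectangle of $k$ columns, the first $k + 1$ parts being
  $a_j + j$ and the other parts $\beta$, belongs $\det (p_{a_j + l})_{j, l \le k} \prod p_\beta$
  with power sums $p_l$. At a point with values $y_0, \dots, y_k$ of multiplicities $m_0, \dots, m_k$
  the determinant is $\prod m_i \det (y_i^{a_j}) \det V(y)$, and it vanishes at points with fewer
  distinct values. For fixed distinct $y_i$ the power sums $p_1, \dots, p_k$ are independent affine
  functions of the multiplicities, so these polynomials are linearly independent as functions on
  the points with at most $r$ distinct values, where $I$ vanishes.\<close>

section \<open>Polynomials\<close>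

text \<open>Both bounds are indexed by the same set \<open>durfee_data r d\<close>, in which n does
  not occur; its cardinality is the dimension for all large n. Only the vanishing of I at points
  with at most r distinct values enters, not a description of its vanishing ideal. The rectangle has
  one more row than columns because k + 1 values y_0, ..., y_k are free coordinates, seen by the k +
  1 exponents a_j, whereas their multiplicities add up to n and leave k degrees of freedom, seen by
  p_1, ..., p_k. The determinant factor makes the system triangular: at points with k + 1 distinct
  values all polynomials with a larger rectangle vanish, and the coefficients with a smaller one are
  zero by induction. Multiplicities are positive integers with a prescribed sum, so polynomial
  identities in them are first known only on a finite grid. The degree in each multiplicity is at
  most d, so d + 1 values per coordinate suffice; this is the origin of the bound r (d + 1) < n.
  Characteristic 0 makes n! invertible, and keeps positive multiplicities nonzero and distinct
  integers distinct in K.\<close>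

lemma scale_conv_mult: "scale c p = Poly_Mapping.single 0 c * p"
  by (simp add: scale_def mult_map_scale_conv_mult)

lemma mpoly_eq_sum_monomials:
  "p = (\<Sum>m\<in>Poly_Mapping.keys p. Poly_Mapping.single m (Poly_Mapping.lookup p m))"
  by (rule poly_mapping_eqI) (simp add: lookup_sum lookup_single when_def in_keys_iff)

lemma mpoly_induct [case_names zero monomial add]:
  fixes p :: "'k::comm_ring_1 mpoly"
  assumes "P 0" "\<And>m c. P (Poly_Mapping.single m c)" "\<And>p q. P p \<Longrightarrow> P q \<Longrightarrow> P (p + q)"
  shows "P p"
proof -
  have "P (\<Sum>m\<in>A. Poly_Mapping.single m (Poly_Mapping.lookup p m))" if "finite A" for A
    using that by (induction A) (auto intro: assms)
  then show ?thesis
    using mpoly_eq_sum_monomials[of p] by (metis finite_keys)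
qed

text \<open>Both sides are additive in each factor, so monomials suffice. This serves evaluation as
  well as the action on variables.\<close>

lemma additive_multiplicativeI:
  fixes h :: "'k::comm_ring_1 mpoly \<Rightarrow> 'b::comm_ring_1"
  assumes add: "\<And>p q. h (p + q) = h p + h q"
    and mult: "\<And>m c m' c'. h (Poly_Mapping.single m c * Poly_Mapping.single m' c') =
      h (Poly_Mapping.single m c) * h (Poly_Mapping.single m' c')"
  shows "h (p * q) = h p * h q"
proof -
  have zero: "h 0 = 0" using add[of 0 0] by simp
  show ?thesis
  proof (induction p rule: mpoly_induct)
    case (monomial m c)
    show ?case
      by (induction q rule: mpoly_induct) (auto simp: zero mult add distrib_left)
  qed (auto simp: zero add distrib_right)
qed

subsection \<open>Evaluation\<close>

definition eval_monomial :: "(nat \<Rightarrow> 'k::comm_ring_1) \<Rightarrow> (nat \<Rightarrow>\<^sub>0 nat) \<Rightarrow> 'k" where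
  "eval_monomial x m = (\<Prod>i\<in>Poly_Mapping.keys m. x i ^ Poly_Mapping.lookup m i)"

definition eval_poly :: "(nat \<Rightarrow> 'k::comm_ring_1) \<Rightarrow> 'k mpoly \<Rightarrow> 'k" where
  "eval_poly x p =
     (\<Sum>m\<in>Poly_Mapping.keys p. Poly_Mapping.lookup p m * eval_monomial x m)"

lemma eval_monomial_superset:
  assumes "finite A" "Poly_Mapping.keys m \<subseteq> A"
  shows "eval_monomial x m = (\<Prod>i\<in>A. x i ^ Poly_Mapping.lookup m i)"
  unfolding eval_monomial_def
  by (rule prod.mono_neutral_left) (use assms in \<open>auto simp: in_keys_iff\<close>)

lemma eval_monomial_add: "eval_monomial x (m + m') = eval_monomial x m * eval_monomial x m'"
proof -
  let ?A = "Poly_Mapping.keys m \<union> Poly_Mapping.keys m'"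
  have "Poly_Mapping.keys (m + m') \<subseteq> ?A" by (rule keys_add)
  then show ?thesis
    by (simp add: eval_monomial_superset[of ?A] lookup_add power_add prod.distrib)
qed

lemma eval_poly_superset:
  assumes "finite A" "Poly_Mapping.keys p \<subseteq> A"
  shows "eval_poly x p = (\<Sum>m\<in>A. Poly_Mapping.lookup p m * eval_monomial x m)"
  unfolding eval_poly_def
  by (rule sum.mono_neutral_left) (use assms in \<open>auto simp: in_keys_iff\<close>)

lemma eval_poly_single [simp]: "eval_poly x (Poly_Mapping.single m c) = c * eval_monomial x m"
  by (simp add: eval_poly_def)

lemma eval_poly_add: "eval_poly x (p + q) = eval_poly x p + eval_poly x q"
proof -
  let ?A = "Poly_Mapping.keys p \<union> Poly_Mapping.keys q"
  have "Poly_Mapping.keys (p + q) \<subseteq> ?A" by (rule keys_add)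
  then show ?thesis
    by (simp add: eval_poly_superset[of ?A] lookup_add distrib_right sum.distrib)
qed

lemma eval_poly_mult: "eval_poly x (p * q) = eval_poly x p * eval_poly x q"
  by (rule additive_multiplicativeI) (auto simp: eval_poly_add mult_single eval_monomial_add)

lemma eval_poly_zero [simp]: "eval_poly x 0 = 0"
  by (simp add: eval_poly_def)

lemma eval_poly_one [simp]: "eval_poly x 1 = 1"
  using eval_poly_single[of x 0 1] by (simp add: eval_monomial_def)

interpretation eval_poly: comm_ring_hom "eval_poly x"
  by unfold_locales (auto simp: eval_poly_add eval_poly_mult)

lemma eval_poly_Var [simp]: "eval_poly x (Var i) = x i"
  by (simp add: Var_def eval_monomial_def)

lemma eval_poly_scale: "eval_poly x (scale c p) = c * eval_poly x p"
  by (simp add: scale_conv_mult eval_poly_mult eval_monomial_def)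

subsection \<open>Permuting the variables\<close>

text \<open>\<open>permute_vars\<close> pulls coefficients back along \<sigma>, which on a single
  monomial pushes the exponents forward; hence the inverse.\<close>

definition permute_exponents :: "(nat \<Rightarrow> nat) \<Rightarrow> (nat \<Rightarrow>\<^sub>0 nat) \<Rightarrow> (nat \<Rightarrow>\<^sub>0 nat)" where
  "permute_exponents \<sigma> m = Poly_Mapping.map_key (Hilbert_Choice.inv \<sigma>) m"

lemma lookup_permute_exponents:
  "bij \<sigma> \<Longrightarrow> Poly_Mapping.lookup (permute_exponents \<sigma> m) i = Poly_Mapping.lookup m (Hilbert_Choice.inv \<sigma> i)"
  by (simp add: permute_exponents_def map_key.rep_eq bij_is_inj bij_imp_bij_inv)

lemma permute_exponents_add:
  "bij \<sigma> \<Longrightarrow> permute_exponents \<sigma> (m + m') = permute_exponents \<sigma> m + permute_exponents \<sigma> m'"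
  by (rule poly_mapping_eqI) (simp add: lookup_permute_exponents lookup_add)

text \<open>Surjectivity of \<sigma> makes the pullback of exponent vectors injective.
  \<open>permute_vars\<close> applies \<open>map_key\<close> along this pullback, and
  \<open>map_key\<close> is composition only along injective maps.\<close>

lemma inj_map_key:
  assumes "bij \<sigma>"
  shows "inj (Poly_Mapping.map_key \<sigma> :: (nat \<Rightarrow>\<^sub>0 nat) \<Rightarrow> _)"
proof (rule injI, rule poly_mapping_eqI)
  fix x y :: "nat \<Rightarrow>\<^sub>0 nat" and k
  assume "Poly_Mapping.map_key \<sigma> x = Poly_Mapping.map_key \<sigma> y"
  then have "Poly_Mapping.lookup x (\<sigma> j) = Poly_Mapping.lookup y (\<sigma> j)" for j
    by (metis assms bij_is_inj comp_apply map_key.rep_eq)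
  then show "Poly_Mapping.lookup x k = Poly_Mapping.lookup y k"
    using assms by (metis bij_pointE)
qed

lemma permute_vars_single:
  assumes "bij \<sigma>"
  shows "permute_vars \<sigma> (Poly_Mapping.single m c) = Poly_Mapping.single (permute_exponents \<sigma> m) c"
proof -
  have "Poly_Mapping.map_key \<sigma> (permute_exponents \<sigma> m) = m"
    using assms
    by (intro poly_mapping_eqI)
      (simp add: map_key.rep_eq bij_is_inj lookup_permute_exponents)
  then show ?thesis
    unfolding permute_vars_def using map_key_single[OF inj_map_key[OF assms]] by metis
qed

lemma permute_vars_add:
  "bij \<sigma> \<Longrightarrow> permute_vars \<sigma> (p + q) = permute_vars \<sigma> p + permute_vars \<sigma> q"
  unfolding permute_vars_def by (rule map_key_plus) (rule inj_map_key)

lemma permute_vars_hom: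
  assumes "bij \<sigma>"
  shows "comm_ring_hom (permute_vars \<sigma> :: 'k::comm_ring_1 mpoly \<Rightarrow> _)"
proof
  show "permute_vars \<sigma> (p * q) = permute_vars \<sigma> p * permute_vars \<sigma> q" for p q :: "'k mpoly"
    by (rule additive_multiplicativeI)
      (auto simp: assms permute_vars_add mult_single permute_vars_single permute_exponents_add)
  have "permute_exponents \<sigma> 0 = 0"
    using assms by (intro poly_mapping_eqI) (simp add: lookup_permute_exponents)
  then show "permute_vars \<sigma> 1 = (1 :: 'k mpoly)"
    using permute_vars_single[OF assms, of 0 "1::'k"] by simp
  show "permute_vars \<sigma> 0 = (0 :: 'k mpoly)"
    unfolding permute_vars_def by (simp add: inj_map_key[OF assms])
qed (simp add: assms permute_vars_add)

lemma permute_vars_scale: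
  assumes "bij \<sigma>"
  shows "permute_vars \<sigma> (scale c p) = scale c (permute_vars \<sigma> p)"
proof -
  interpret comm_ring_hom "permute_vars \<sigma> :: 'a mpoly \<Rightarrow> _" by (rule permute_vars_hom) fact
  have "permute_exponents \<sigma> 0 = 0"
    using assms by (intro poly_mapping_eqI) (simp add: lookup_permute_exponents)
  then show ?thesis
    by (simp add: scale_conv_mult hom_mult permute_vars_single assms)
qed

lemma permute_vars_permute_vars:
  assumes "bij \<sigma>" "bij \<tau>"
  shows "permute_vars \<sigma> (permute_vars \<tau> p) = permute_vars (\<sigma> \<circ> \<tau>) p"
proof -
  define \<rho> where "\<rho> = \<sigma> \<circ> \<tau>"
  have b: "bij \<rho>" unfolding \<rho>_def using assms by (rule bij_comp[rotated])
  interpret \<sigma>: comm_ring_hom "permute_vars \<sigma> :: 'a mpoly \<Rightarrow> _" by (rule permute_vars_hom) fact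
  interpret \<tau>: comm_ring_hom "permute_vars \<tau> :: 'a mpoly \<Rightarrow> _" by (rule permute_vars_hom) fact
  interpret \<rho>: comm_ring_hom "permute_vars \<rho> :: 'a mpoly \<Rightarrow> _" by (rule permute_vars_hom) fact
  have "permute_vars \<sigma> (permute_vars \<tau> p) = permute_vars \<rho> p"
  proof (induction p rule: mpoly_induct)
    case (monomial m c)
    have "Poly_Mapping.lookup (permute_exponents \<sigma> (permute_exponents \<tau> m)) i =
        Poly_Mapping.lookup (permute_exponents \<rho> m) i" for i
    proof -
      have "Hilbert_Choice.inv \<rho> i = Hilbert_Choice.inv \<tau> (Hilbert_Choice.inv \<sigma> i)"
        using o_inv_distrib[OF assms] by (simp add: \<rho>_def)
      then show ?thesis by (simp add: assms b lookup_permute_exponents)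
    qed
    then have "permute_exponents \<sigma> (permute_exponents \<tau> m) = permute_exponents \<rho> m"
      by (rule poly_mapping_eqI)
    then show ?case by (simp add: permute_vars_single assms b)
  qed (simp_all add: assms b permute_vars_add)
  then show ?thesis by (simp only: \<rho>_def)
qed

subsection \<open>Graded and symmetric polynomials\<close>

definition total_degree :: "(nat \<Rightarrow>\<^sub>0 nat) \<Rightarrow> nat" where
  "total_degree m = (\<Sum>i\<in>Poly_Mapping.keys m. Poly_Mapping.lookup m i)"

lemma total_degree_superset:
  assumes "finite A" "Poly_Mapping.keys m \<subseteq> A"
  shows "total_degree m = (\<Sum>i\<in>A. Poly_Mapping.lookup m i)"
  unfolding total_degree_def
  by (rule sum.mono_neutral_left) (use assms in \<open>auto simp: in_keys_iff\<close>)

lemma total_degree_add: "total_degree (m + m') = total_degree m + total_degree m'"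
proof -
  let ?A = "Poly_Mapping.keys m \<union> Poly_Mapping.keys m'"
  have "Poly_Mapping.keys (m + m') \<subseteq> ?A" by (rule keys_add)
  then show ?thesis
    by (simp add: total_degree_superset[of ?A] lookup_add sum.distrib)
qed

lemma homogeneous_iff: "p \<in> homogeneous d \<longleftrightarrow> (\<forall>m\<in>Poly_Mapping.keys p. total_degree m = d)"
  by (simp add: homogeneous_def total_degree_def)

lemma homogeneous_zero [simp]: "0 \<in> homogeneous d"
  by (simp add: homogeneous_iff)

lemma homogeneous_one [simp]: "1 \<in> homogeneous 0"
  by (simp add: homogeneous_iff total_degree_def)

lemma homogeneous_add: "p \<in> homogeneous d \<Longrightarrow> q \<in> homogeneous d \<Longrightarrow> p + q \<in> homogeneous d"
  using keys_add[of p q] by (auto simp: homogeneous_iff)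

lemma homogeneous_mult:
  "p \<in> homogeneous d \<Longrightarrow> q \<in> homogeneous d' \<Longrightarrow> p * q \<in> homogeneous (d + d')"
  using keys_mult[of p q] by (fastforce simp: homogeneous_iff total_degree_add)

lemma homogeneous_scale: "p \<in> homogeneous d \<Longrightarrow> scale c p \<in> homogeneous d"
  using homogeneous_mult[of "Poly_Mapping.single 0 c" 0 p d]
  by (simp add: scale_conv_mult homogeneous_iff total_degree_def)

lemma homogeneous_sum: "(\<And>i. i \<in> A \<Longrightarrow> f i \<in> homogeneous d) \<Longrightarrow> sum f A \<in> homogeneous d"
  by (induction A rule: infinite_finite_induct) (auto intro: homogeneous_add)

lemma homogeneous_prod:
  "(\<And>i. i \<in> A \<Longrightarrow> f i \<in> homogeneous (d i)) \<Longrightarrow> prod f A \<in> homogeneous (sum d A)"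
  by (induction A rule: infinite_finite_induct) (auto intro: homogeneous_mult)

lemma homogeneous_power: "p \<in> homogeneous d \<Longrightarrow> p ^ n \<in> homogeneous (n * d)"
  by (induction n) (auto intro: homogeneous_mult)

lemma homogeneous_Var: "Var i \<in> homogeneous 1"
  by (simp add: homogeneous_iff Var_def total_degree_def)

lemma homogeneous_signof_mult: "p \<in> homogeneous d \<Longrightarrow> signof \<pi> * p \<in> homogeneous d"
  by (cases \<pi> rule: sign_cases) (auto simp: homogeneous_iff)

lemma polys_in_zero [simp]: "0 \<in> polys_in n"
  by (simp add: polys_in_def)

lemma polys_in_one [simp]: "1 \<in> polys_in n"
  by (simp add: polys_in_def)

lemma polys_in_add: "p \<in> polys_in n \<Longrightarrow> q \<in> polys_in n \<Longrightarrow> p + q \<in> polys_in n"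
  using keys_add[of p q] by (auto simp: polys_in_def)

lemma polys_in_mult:
  assumes "p \<in> polys_in n" "q \<in> polys_in n"
  shows "p * q \<in> polys_in n"
  unfolding polys_in_def
proof (intro CollectI ballI)
  fix m assume "m \<in> Poly_Mapping.keys (p * q)"
  then obtain a b where "m = a + b" "a \<in> Poly_Mapping.keys p" "b \<in> Poly_Mapping.keys q"
    using keys_mult[of p q] by blast
  then show "Poly_Mapping.keys m \<subseteq> {..<n}"
    using assms keys_add[of a b] by (fastforce simp: polys_in_def)
qed

lemma polys_in_sum: "(\<And>i. i \<in> A \<Longrightarrow> f i \<in> polys_in n) \<Longrightarrow> sum f A \<in> polys_in n"
  by (induction A rule: infinite_finite_induct) (auto intro: polys_in_add)

lemma polys_in_power: "p \<in> polys_in n \<Longrightarrow> p ^ k \<in> polys_in n"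
  by (induction k) (auto intro: polys_in_mult)

lemma polys_in_Var: "i < n \<Longrightarrow> Var i \<in> polys_in n"
  by (simp add: polys_in_def Var_def)

lemma sym_polys_zero [simp]: "0 \<in> sym_polys n"
  using permute_vars_hom comm_ring_hom.axioms(1)
  by (auto simp: sym_polys_def permute_vars_def inj_map_key permutes_bij)

lemma sym_polys_one: "1 \<in> sym_polys n"
proof -
  have "permute_vars \<sigma> 1 = (1 :: 'a mpoly)" if "\<sigma> permutes {..<n}" for \<sigma>
  proof -
    interpret comm_ring_hom "permute_vars \<sigma> :: 'a mpoly \<Rightarrow> _"
      using that by (intro permute_vars_hom permutes_bij)
    show ?thesis by simp
  qed
  then show ?thesis by (simp add: sym_polys_def)
qed

lemma sym_polys_add: "p \<in> sym_polys n \<Longrightarrow> q \<in> sym_polys n \<Longrightarrow> p + q \<in> sym_polys n"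
  by (auto simp: sym_polys_def polys_in_add permute_vars_add permutes_bij)

lemma permute_vars_mult:
  assumes "bij \<sigma>"
  shows "permute_vars \<sigma> (p * q) = permute_vars \<sigma> p * permute_vars \<sigma> q"
proof -
  interpret comm_ring_hom "permute_vars \<sigma> :: 'a mpoly \<Rightarrow> _" by (rule permute_vars_hom) fact
  show ?thesis by (rule hom_mult)
qed

lemma sym_polys_mult: "p \<in> sym_polys n \<Longrightarrow> q \<in> sym_polys n \<Longrightarrow> p * q \<in> sym_polys n"
  by (simp add: sym_polys_def polys_in_mult permutes_bij permute_vars_mult)

lemma sym_polys_scale: 
  assumes "p \<in> sym_polys n"
  shows "scale c p \<in> sym_polys n"
proof -
  have "Poly_Mapping.single 0 c \<in> polys_in n" by (simp add: polys_in_def)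
  then have "scale c p \<in> polys_in n"
    using assms by (auto simp: scale_conv_mult sym_polys_def intro: polys_in_mult)
  then show ?thesis
    using assms by (auto simp: sym_polys_def permutes_bij permute_vars_scale)
qed

lemma sym_polys_prod: "(\<And>i. i \<in> A \<Longrightarrow> f i \<in> sym_polys n) \<Longrightarrow> prod f A \<in> sym_polys n"
  by (induction A rule: infinite_finite_induct) (auto intro: sym_polys_mult sym_polys_one)

lemma sym_polys_sum: "(\<And>i. i \<in> A \<Longrightarrow> f i \<in> sym_polys n) \<Longrightarrow> sum f A \<in> sym_polys n"
  by (induction A rule: infinite_finite_induct) (auto intro: sym_polys_add)

lemma sym_polys_power: "p \<in> sym_polys n \<Longrightarrow> p ^ k \<in> sym_polys n"
  by (induction k) (auto intro: sym_polys_mult sym_polys_one)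

section \<open>The dimension of a quotient\<close>

text \<open>In the application \<open>U\<close> is a single degree while \<open>W\<close> has
  elements of all degrees, so the cosets form U modulo the intersection of U and W.\<close>

locale mpoly_subspaces =
  fixes U W :: "'k::field mpoly set"
  assumes U: "0 \<in> U" "\<And>u v. u \<in> U \<Longrightarrow> v \<in> U \<Longrightarrow> u + v \<in> U" "\<And>c u. u \<in> U \<Longrightarrow> scale c u \<in> U"
    and W: "0 \<in> W" "\<And>u v. u \<in> W \<Longrightarrow> v \<in> W \<Longrightarrow> u + v \<in> W" "\<And>c u. u \<in> W \<Longrightarrow> scale c u \<in> W"
begin

lemma minus_W: "u \<in> W \<Longrightarrow> - u \<in> W"
  using W(3)[of u "-1"] by (simp add: scale_conv_mult single_uminus)

lemma coset_eq_iff: "u +o W = v +o W \<longleftrightarrow> u - v \<in> W"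
proof
  assume "u +o W = v +o W"
  moreover have "u \<in> u +o W" using W(1) by (force simp: elt_set_plus_def)
  ultimately show "u - v \<in> W" by (auto simp: elt_set_plus_def)
next
  have *: "u +o W \<subseteq> v +o W" if "u - v \<in> W" for u v
  proof
    fix x assume "x \<in> u +o W"
    then obtain w where w: "w \<in> W" "x = u + w" by (auto simp: elt_set_plus_def)
    then have "x = v + ((u - v) + w)" by simp
    then show "x \<in> v +o W"
      unfolding elt_set_plus_def using W(2)[OF that w(1)] by blast
  qed
  assume "u - v \<in> W"
  then show "u +o W = v +o W"
    using *[of u v] *[of v u] minus_W[of "u - v"] by auto
qed

lemma coset_add: "(u +o W) + (v +o W) = (u + v) +o W"
proof -
  have "W + W = W"
  proof
    show "W \<subseteq> W + W" using W(1) by (force simp: set_plus_def)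
  qed (use W(2) in \<open>auto simp: set_plus_def\<close>)
  then show ?thesis
    by (metis set_plus_rearrange2 set_plus_rearrange)
qed

lemma coset_scale: "scale c ` (u +o W) + W = scale c u +o W"
proof
  show "scale c ` (u +o W) + W \<subseteq> scale c u +o W"
  proof
    fix x assume "x \<in> scale c ` (u +o W) + W"
    then obtain a b where ab: "a \<in> W" "b \<in> W" "x = scale c (u + a) + b"
      by (auto simp: set_plus_def elt_set_plus_def)
    then have "x = scale c u + (scale c a + b)" by (simp add: scale_conv_mult algebra_simps)
    with ab W(2,3) show "x \<in> scale c u +o W" by (auto simp: elt_set_plus_def)
  qed
  show "scale c u +o W \<subseteq> scale c ` (u +o W) + W"
  proof
    fix x assume "x \<in> scale c u +o W"
    then obtain a where "a \<in> W" "x = scale c (u + 0) + a" by (auto simp: elt_set_plus_def)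
    with W(1) show "x \<in> scale c ` (u +o W) + W"
      unfolding set_plus_def elt_set_plus_def by blast
  qed
qed

abbreviation Q where "Q \<equiv> coset_space U W"

lemma vectorspace_Q: "vectorspace class_ring Q"
  by (rule vectorspace_coset_space) (use U W in auto)

lemma finsum_coset:
  assumes "finite A" "\<And>i. i \<in> A \<Longrightarrow> f i \<in> U" "\<And>i. i \<in> A \<Longrightarrow> g i = f i +o W"
  shows "finsum Q g A = sum f A +o W"
proof -
  interpret vectorspace class_ring Q by (rule vectorspace_Q)
  show ?thesis
    using assms
  proof (induction A)
    case empty
    have "finsum Q g {} = zero Q" by (rule M.finsum_empty)
    then show ?case by (simp add: coset_space_def elt_set_plus_def)
  next
    case (insert i A)
    have "g \<in> A \<rightarrow> carrier Q" "g i \<in> carrier Q"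
      using insert.prems by (auto simp: coset_space_def)
    then have "finsum Q g (insert i A) = add Q (g i) (finsum Q g A)"
      using insert.hyps by (intro M.finsum_insert) auto
    also have "\<dots> = (f i +o W) + (sum f A +o W)"
      using insert by (simp add: coset_space_def)
    finally show ?case using insert.hyps by (simp add: coset_add)
  qed
qed

text \<open>\<open>lincomb\<close> sums over a set of vectors; injectivity keeps different indices
  from merging into one coset.\<close>

lemma lincomb_coset:
  assumes "finite A" "\<And>i. i \<in> A \<Longrightarrow> f i \<in> U" "inj_on (\<lambda>i. f i +o W) A"
  shows "module.lincomb Q a ((\<lambda>i. f i +o W) ` A) =
    (\<Sum>i\<in>A. scale (a (f i +o W)) (f i)) +o W"
proof -
  interpret vectorspace class_ring Q by (rule vectorspace_Q)
  have "lincomb a ((\<lambda>i. f i +o W) ` A) =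
      finsum Q (\<lambda>i. smult Q (a (f i +o W)) (f i +o W)) A"
    unfolding lincomb_def
    by (subst M.finsum_reindex[OF _ assms(3)]) (use assms(2) U(3) in \<open>auto simp: coset_space_def coset_scale\<close>)
  also have "\<dots> = (\<Sum>i\<in>A. scale (a (f i +o W)) (f i)) +o W"
    by (rule finsum_coset) (use assms U(3) in \<open>auto simp: coset_space_def coset_scale\<close>)
  finally show ?thesis .
qed

text \<open>A squeeze: the spanning set gives dim \<le> card B \<le> card T, and independence of the
  family \<open>G\<close> gives card T \<le> dim. No basis has to be exhibited, and \<open>B\<close>
  and \<open>G\<close> may be unrelated.\<close>

lemma dim_coset_space:
  assumes B: "finite B" "B \<subseteq> U"
    and span: "\<And>u. u \<in> U \<Longrightarrow> \<exists>c. u - (\<Sum>b\<in>B. scale (c b) b) \<in> W"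
    and T: "finite T" "\<And>t. t \<in> T \<Longrightarrow> G t \<in> U"
    and indep: "\<And>c. (\<Sum>t\<in>T. scale (c t) (G t)) \<in> W \<Longrightarrow> \<forall>t\<in>T. c t = 0"
    and card: "card B \<le> card T"
  shows "vectorspace.dim class_ring Q = card T"
proof -
  interpret vectorspace class_ring Q by (rule vectorspace_Q)
  let ?B = "(\<lambda>b. b +o W) ` B"
  obtain B' where B': "B' \<subseteq> B" "inj_on (\<lambda>b. b +o W) B'" "?B = (\<lambda>b. b +o W) ` B'"
    by (meson subset_image_inj subset_refl)
  have B'': "finite B'" "B' \<subseteq> U" using B' B finite_subset by auto
  have "gen_set ?B"
  proof
    show "span ?B \<subseteq> carrier Q"
      using B by (intro span_is_subset2) (auto simp: coset_space_def)
    show "carrier Q \<subseteq> span ?B"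
    proof
      fix X assume "X \<in> carrier Q"
      then obtain u where u: "u \<in> U" "X = u +o W" by (auto simp: coset_space_def)
      obtain c where c: "u - (\<Sum>b\<in>B. scale (c b) b) \<in> W" using span u(1) by blast
      have "X = (\<Sum>b\<in>B. scale (c b) b) +o W"
        unfolding u(2) coset_eq_iff by (rule c)
      also have "\<dots> = finsum Q (\<lambda>b. smult Q (c b) (b +o W)) B"
        by (rule finsum_coset[symmetric])
          (use B U(3) in \<open>auto simp: coset_space_def coset_scale\<close>)
      also have "\<dots> \<in> span ?B"
      proof -
        have sub: "?B \<subseteq> carrier Q" using B by (auto simp: coset_space_def)
        have "finsum Q (\<lambda>b. smult Q (c b) (b +o W)) A \<in> span ?B" if "finite A" "A \<subseteq> B" for A
          using that
        proof (induction A)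
          case empty
          then show ?case using span_zero by simp
        next
          case (insert b A)
          have mem: "smult Q (c x) (x +o W) \<in> carrier Q" if "x \<in> B" for x
            using that B(2) U(3) by (auto simp: coset_space_def coset_scale)
          have "finsum Q (\<lambda>b. smult Q (c b) (b +o W)) (insert b A) =
              add Q (smult Q (c b) (b +o W)) (finsum Q (\<lambda>b. smult Q (c b) (b +o W)) A)"
            using insert mem by (intro M.finsum_insert) auto
          moreover have "smult Q (c b) (b +o W) \<in> span ?B"
            using insert.prems span_mem[OF sub]
            by (intro submodule.smult_closed[OF span_is_submodule[OF sub]])
              (auto simp: class_ring_simps)
          ultimately show ?case
            using insert span_add1[OF sub] by auto
        qed
        then show ?thesis using B(1) by blast
      qed
      finally show "X \<in> span ?B" .
    qed
  qed
  then have gen: "gen_set ?B" .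
  have sub: "?B \<subseteq> carrier Q" using B by (auto simp: coset_space_def)
  have "dim \<le> card ?B" using B sub gen by (intro gen_ge_dim) auto
  then have le: "dim \<le> card T" using card_image_le[OF B(1), of "\<lambda>b. b +o W"] card by linarith
  have fd: fin_dim unfolding fin_dim_def using B sub gen by blast
  have inj: "inj_on (\<lambda>t. G t +o W) T"
  proof (rule inj_onI, rule ccontr)
    fix s t assume st: "s \<in> T" "t \<in> T" "G s +o W = G t +o W" "s \<noteq> t"
    \<comment> \<open>Two indices with the same coset would give a relation with coefficients 1 and
      -1.\<close>
    let ?c = "\<lambda>i. if i = s then 1 else if i = t then -1 else (0::'k)"
    have "(\<Sum>i\<in>T. scale (?c i) (G i)) = (\<Sum>i\<in>{s,t}. scale (?c i) (G i))"
      using st T(1) by (intro sum.mono_neutral_right) (auto simp: scale_conv_mult)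
    also have "\<dots> = G s - G t"
      using st(4) by (simp add: scale_conv_mult single_uminus)
    also have "\<dots> \<in> W" using st(3) by (simp add: coset_eq_iff)
    finally have "?c s = 0" using indep[of ?c] st(1) by blast
    then show False by simp
  qed
  have "lin_indpt ((\<lambda>t. G t +o W) ` T)"
  proof
    assume "lin_dep ((\<lambda>t. G t +o W) ` T)"
    then obtain A a v where A: "finite A" "A \<subseteq> (\<lambda>t. G t +o W) ` T"
        "lincomb a A = zero Q" "v \<in> A" "a v \<noteq> 0"
      unfolding lin_dep_def by (auto simp: class_ring_simps)
    \<comment> \<open>The indices whose cosets occur in the dependence; the coefficients are
      extended by 0 to all of \<open>T\<close> below.\<close>
    define S where "S = {t \<in> T. G t +o W \<in> A}"
    have S: "A = (\<lambda>t. G t +o W) ` S" "S \<subseteq> T" using A(2) by (auto simp: S_def)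
    have "(\<Sum>t\<in>S. scale (a (G t +o W)) (G t)) +o W = W"
      using A(3) lincomb_coset[of S G a] S T inj by (auto simp: coset_space_def finite_subset inj_on_subset)
    then have "(\<Sum>t\<in>S. scale (a (G t +o W)) (G t)) \<in> W"
      using coset_eq_iff[of _ 0] by (simp add: elt_set_plus_def)
    also have "(\<Sum>t\<in>S. scale (a (G t +o W)) (G t)) =
        (\<Sum>t\<in>T. scale (if t \<in> S then a (G t +o W) else 0) (G t))"
      using S(2) T(1) by (intro sum.mono_neutral_cong_left) (auto simp: scale_conv_mult)
    finally have "\<forall>t\<in>T. (if t \<in> S then a (G t +o W) else 0) = 0" by (rule indep)
    then have "\<forall>t\<in>S. a (G t +o W) = 0" using S(2) by (auto split: if_splits)
    then show False using A(4,5) S(1) by auto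
  qed
  then have "card ((\<lambda>t. G t +o W) ` T) \<le> dim"
    using T(2) by (intro li_le_dim[OF fd]) (auto simp: coset_space_def)
  then show ?thesis using le card_image[OF inj] by simp
qed

end

section \<open>The ideal\<close>

lemma ideal_mult: "p \<in> hook_specht_ideal r \<Longrightarrow> q * p \<in> hook_specht_ideal r"
  unfolding hook_specht_ideal_def by (rule ideal.span_scale)

lemma ideal_scale: "p \<in> hook_specht_ideal r \<Longrightarrow> scale c p \<in> hook_specht_ideal r"
  by (simp add: scale_conv_mult ideal_mult)

lemma ideal_add:
  "p \<in> hook_specht_ideal r \<Longrightarrow> q \<in> hook_specht_ideal r \<Longrightarrow> p + q \<in> hook_specht_ideal r"
  unfolding hook_specht_ideal_def by (rule ideal.span_add)

lemma ideal_zero: "0 \<in> hook_specht_ideal r"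
  unfolding hook_specht_ideal_def by (rule ideal.span_zero)

lemma ideal_sum: "(\<And>i. i \<in> A \<Longrightarrow> f i \<in> hook_specht_ideal r) \<Longrightarrow> sum f A \<in> hook_specht_ideal r"
  unfolding hook_specht_ideal_def by (rule ideal.span_sum)

lemma vandermonde_in_ideal: "det (vandermonde r (\<lambda>j. Var (i j))) \<in> hook_specht_ideal r"
  unfolding hook_specht_ideal_def by (rule ideal.span_base) auto

lemma (in comm_ring_hom) hom_det_vandermonde:
  "hom (det (vandermonde r a)) = det (vandermonde r (\<lambda>j. hom (a j)))"
proof -
  have "map_mat hom (vandermonde r a) = vandermonde r (\<lambda>j. hom (a j))"
    by (rule eq_matI) (auto simp: vandermonde_def hom_distribs)
  then show ?thesis by (metis hom_det)
qed

text \<open>A permutation sends the generator with index map i to the one with index map \<sigma>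
  \<circ> i, which is again a generator since all index maps are allowed.\<close>

lemma permute_vars_ideal:
  assumes "bij \<sigma>" "p \<in> hook_specht_ideal r"
  shows "permute_vars \<sigma> p \<in> hook_specht_ideal r"
proof -
  interpret comm_ring_hom "permute_vars \<sigma> :: 'a mpoly \<Rightarrow> _" by (rule permute_vars_hom) fact
  show ?thesis
    using assms(2) unfolding hook_specht_ideal_def[of r]
  proof (induction rule: ideal.span_induct_alt)
    case base
    then show ?case by (simp add: ideal.span_zero)
  next
    case (step c x y)
    then obtain i where "x = det (vandermonde r (\<lambda>j. Var (i j)))" by auto
    then have "permute_vars \<sigma> x = det (vandermonde r (\<lambda>j. Var (\<sigma> (i j))))"
      by (simp add: hom_det_vandermonde permute_vars_Var assms)
    then have "permute_vars \<sigma> x \<in> hook_specht_ideal r"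
      using vandermonde_in_ideal[of r "\<lambda>j. \<sigma> (i j)"] by simp
    then show ?case
      using step.IH unfolding hom_add hom_mult
      by (fold hook_specht_ideal_def) (intro ideal_add ideal_mult)
  qed
qed

section \<open>Monomial symmetric polynomials\<close>

lemma permute_vars_conv_sum:
  assumes "bij \<sigma>"
  shows "permute_vars \<sigma> p = (\<Sum>m\<in>Poly_Mapping.keys p.
    Poly_Mapping.single (permute_exponents \<sigma> m) (Poly_Mapping.lookup p m))"
proof -
  interpret comm_ring_hom "permute_vars \<sigma> :: 'a mpoly \<Rightarrow> _" by (rule permute_vars_hom) fact
  have "permute_vars \<sigma> p = permute_vars \<sigma>
      (\<Sum>m\<in>Poly_Mapping.keys p. Poly_Mapping.single m (Poly_Mapping.lookup p m))"
    by (rule arg_cong) (rule mpoly_eq_sum_monomials)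
  also have "\<dots> = (\<Sum>m\<in>Poly_Mapping.keys p.
      Poly_Mapping.single (permute_exponents \<sigma> m) (Poly_Mapping.lookup p m))"
    unfolding hom_sum by (intro sum.cong refl permute_vars_single assms)
  finally show ?thesis .
qed

lemma keys_permute_exponents:
  "bij \<sigma> \<Longrightarrow> Poly_Mapping.keys (permute_exponents \<sigma> m) = \<sigma> ` Poly_Mapping.keys m"
  using bij_image_Collect_eq[of \<sigma> "\<lambda>k. Poly_Mapping.lookup m k \<noteq> 0"]
  by (simp add: keys.rep_eq lookup_permute_exponents)

lemma total_degree_permute_exponents:
  "bij \<sigma> \<Longrightarrow> total_degree (permute_exponents \<sigma> m) = total_degree m"
  unfolding total_degree_def keys_permute_exponents
  by (subst sum.reindex)
    (auto simp: lookup_permute_exponents bij_is_inj intro: inj_on_subset[OF bij_is_inj])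

lemma permute_vars_homogeneous:
  assumes "bij \<sigma>" "p \<in> homogeneous d"
  shows "permute_vars \<sigma> p \<in> homogeneous d"
  unfolding permute_vars_conv_sum[OF assms(1)]
  using assms by (intro homogeneous_sum) (auto simp: homogeneous_iff total_degree_permute_exponents)

lemma permute_vars_polys_in:
  assumes "\<sigma> permutes {..<n}" "p \<in> polys_in n"
  shows "permute_vars \<sigma> p \<in> polys_in n"
  unfolding permute_vars_conv_sum[OF permutes_bij[OF assms(1)]]
proof (intro polys_in_sum)
  fix m assume "m \<in> Poly_Mapping.keys p"
  then have "\<sigma> ` Poly_Mapping.keys m \<subseteq> \<sigma> ` {..<n}"
    using assms(2) by (intro image_mono) (auto simp: polys_in_def)
  then show "Poly_Mapping.single (permute_exponents \<sigma> m) (Poly_Mapping.lookup p m) \<in> polys_in n"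
    using assms(1) by (simp add: polys_in_def permutes_image keys_permute_exponents permutes_bij)
qed

text \<open>The sum is not divided by n!, so it makes sense over every coefficient ring; on
  invariants it is multiplication by n!.\<close>

definition symmetrize :: "nat \<Rightarrow> 'k::comm_ring_1 mpoly \<Rightarrow> 'k mpoly" where
  "symmetrize n p = (\<Sum>\<sigma> | \<sigma> permutes {..<n}. permute_vars \<sigma> p)"

lemma symmetrize_zero [simp]: "symmetrize n 0 = 0"
  by (simp add: symmetrize_def permute_vars_def inj_map_key permutes_bij)

lemma symmetrize_add: "symmetrize n (p + q) = symmetrize n p + symmetrize n q"
  unfolding symmetrize_def sum.distrib[symmetric]
  by (rule sum.cong) (auto simp: permute_vars_add permutes_bij)

lemma symmetrize_scale: "symmetrize n (scale c p) = scale c (symmetrize n p)"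
proof -
  have "scale c (symmetrize n p) = (\<Sum>\<sigma> | \<sigma> permutes {..<n}. scale c (permute_vars \<sigma> p))"
    by (simp add: symmetrize_def scale_conv_mult sum_distrib_left)
  then show ?thesis
    by (simp add: symmetrize_def permute_vars_scale permutes_bij)
qed

lemma symmetrize_sum: "symmetrize n (sum f A) = (\<Sum>i\<in>A. symmetrize n (f i))"
  by (induction A rule: infinite_finite_induct) (auto simp: symmetrize_add)

lemma symmetrize_signof: "symmetrize n (signof \<pi> * p) = signof \<pi> * symmetrize n p"
  using symmetrize_scale[of n "-1" p]
  by (cases \<pi> rule: sign_cases) (auto simp: scale_conv_mult single_uminus)

lemma symmetrize_permute_vars:
  assumes "\<tau> permutes {..<n}"
  shows "symmetrize n (permute_vars \<tau> p) = symmetrize n p"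
proof -
  have "symmetrize n (permute_vars \<tau> p) = (\<Sum>\<sigma> | \<sigma> permutes {..<n}. permute_vars (\<sigma> \<circ> \<tau>) p)"
    unfolding symmetrize_def using assms
    by (intro sum.cong) (auto simp: permute_vars_permute_vars permutes_bij simp del: o_apply)
  also have "\<dots> = symmetrize n p"
    unfolding symmetrize_def
    by (rule sum_permutations_compose_right[OF assms, of "\<lambda>\<sigma>. permute_vars \<sigma> p" , symmetric])
  finally show ?thesis .
qed

lemma permute_vars_symmetrize:
  assumes "\<tau> permutes {..<n}"
  shows "permute_vars \<tau> (symmetrize n p) = symmetrize n p"
proof -
  interpret comm_ring_hom "permute_vars \<tau> :: 'a mpoly \<Rightarrow> _"
    using assms by (intro permute_vars_hom permutes_bij)
  have "permute_vars \<tau> (symmetrize n p) = (\<Sum>\<sigma> | \<sigma> permutes {..<n}. permute_vars (\<tau> \<circ> \<sigma>) p)"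
    unfolding symmetrize_def hom_sum using assms
    by (intro sum.cong) (auto simp: permute_vars_permute_vars permutes_bij simp del: o_apply)
  also have "\<dots> = symmetrize n p"
    unfolding symmetrize_def
    by (rule setum_permutations_compose_left[OF assms, of "\<lambda>\<sigma>. permute_vars \<sigma> p", symmetric])
  finally show ?thesis .
qed

lemma symmetrize_sym_polys: "p \<in> polys_in n \<Longrightarrow> symmetrize n p \<in> sym_polys n"
  unfolding sym_polys_def
  by (simp add: permute_vars_symmetrize)
    (auto simp: symmetrize_def intro!: polys_in_sum permute_vars_polys_in)

lemma symmetrize_homogeneous: "p \<in> homogeneous d \<Longrightarrow> symmetrize n p \<in> homogeneous d"
  unfolding symmetrize_def by (auto intro!: homogeneous_sum permute_vars_homogeneous permutes_bij)

lemma symmetrize_ideal: "p \<in> hook_specht_ideal r \<Longrightarrow> symmetrize n p \<in> hook_specht_ideal r"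
  unfolding symmetrize_def by (auto intro!: ideal_sum permute_vars_ideal permutes_bij)

lemma symmetrize_eq:
  assumes "p \<in> sym_polys n"
  shows "symmetrize n p = scale (fact n) p"
proof -
  have "symmetrize n p = (\<Sum>\<sigma> | \<sigma> permutes {..<n}. p)"
    unfolding symmetrize_def using assms by (intro sum.cong) (auto simp: sym_polys_def)
  also have "\<dots> = scale (fact n) p"
  proof -
    have "of_nat (fact n) = Poly_Mapping.single (0 :: nat \<Rightarrow>\<^sub>0 nat) (fact n :: 'a)"
      by (metis single_of_nat of_nat_fact)
    then show ?thesis by (simp add: card_permutations scale_conv_mult del: of_nat_fact)
  qed
  finally show ?thesis .
qed

definition exponents :: "nat \<Rightarrow> (nat \<Rightarrow> nat) \<Rightarrow> (nat \<Rightarrow>\<^sub>0 nat)" where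
  "exponents n e = (\<Sum>i<n. Poly_Mapping.single i (e i))"

lemma lookup_exponents: "Poly_Mapping.lookup (exponents n e) i = (if i < n then e i else 0)"
  by (simp add: exponents_def lookup_sum lookup_single when_def)

lemma exponents_add: "exponents n e + exponents n f = exponents n (\<lambda>i. e i + f i)"
  by (rule poly_mapping_eqI) (simp add: lookup_add lookup_exponents)

lemma keys_exponents: "Poly_Mapping.keys (exponents n e) \<subseteq> {..<n}"
  by (auto simp: in_keys_iff lookup_exponents split: if_splits)

lemma total_degree_exponents: "total_degree (exponents n e) = (\<Sum>i<n. e i)"
  by (subst total_degree_superset[OF _ keys_exponents]) (auto simp: lookup_exponents)

text \<open>The classical monomial symmetric polynomial times the order of the stabilizer of the
  exponent vector. \<open>e\<close> may be unsorted, which lets the straightening terms be written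
  directly.\<close>

definition monomial_sym :: "nat \<Rightarrow> (nat \<Rightarrow> nat) \<Rightarrow> 'k::comm_ring_1 mpoly" where
  "monomial_sym n e = symmetrize n (Poly_Mapping.single (exponents n e) 1)"

lemma monomial_sym_cong: "(\<And>i. i < n \<Longrightarrow> e i = f i) \<Longrightarrow> monomial_sym n e = monomial_sym n f"
  by (simp add: monomial_sym_def exponents_def)

lemma monomial_sym_permute:
  assumes "\<tau> permutes {..<n}"
  shows "(monomial_sym n (\<lambda>i. e (\<tau> i)) :: 'k::comm_ring_1 mpoly) = monomial_sym n e"
proof -
  have "permute_exponents \<tau> (exponents n (\<lambda>i. e (\<tau> i))) = exponents n e"
    using assms permutes_in_image[OF permutes_inv[OF assms]] permutes_inverses(1)[OF assms]
    by (intro poly_mapping_eqI) (auto simp: lookup_permute_exponents permutes_bij lookup_exponents)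
  then show ?thesis
    unfolding monomial_sym_def
    by (subst symmetrize_permute_vars[OF assms, symmetric])
      (simp add: permute_vars_single permutes_bij[OF assms])
qed

lemma monomial_sym_mem:
  assumes "(\<Sum>i<n. e i) = d"
  shows "monomial_sym n e \<in> sym_polys n \<inter> homogeneous d"
  unfolding monomial_sym_def
proof
  show "symmetrize n (Poly_Mapping.single (exponents n e) 1) \<in> sym_polys n"
    using keys_exponents by (intro symmetrize_sym_polys) (simp add: polys_in_def)
  show "symmetrize n (Poly_Mapping.single (exponents n e) 1) \<in> homogeneous d"
    using assms by (intro symmetrize_homogeneous) (simp add: homogeneous_iff total_degree_exponents)
qed

text \<open>An invariant is 1/n! times its symmetrization, and the symmetrization may be taken term
  by term.\<close>

lemma sym_poly_conv_monomial_sym: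
  fixes p :: "'k::field_char_0 mpoly"
  assumes "p \<in> sym_polys n"
  shows "p = (\<Sum>m\<in>Poly_Mapping.keys p.
    scale (Poly_Mapping.lookup p m / fact n) (monomial_sym n (Poly_Mapping.lookup m)))"
proof -
  have mon: "Poly_Mapping.single m (Poly_Mapping.lookup p m) =
      scale (Poly_Mapping.lookup p m) (Poly_Mapping.single (exponents n (Poly_Mapping.lookup m)) 1)"
    if "m \<in> Poly_Mapping.keys p" for m
  proof -
    have "exponents n (Poly_Mapping.lookup m) = m"
    proof (rule poly_mapping_eqI)
      fix i
      have "Poly_Mapping.keys m \<subseteq> {..<n}"
        using assms that by (auto simp: sym_polys_def polys_in_def)
      then show "Poly_Mapping.lookup (exponents n (Poly_Mapping.lookup m)) i = Poly_Mapping.lookup m i"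
        by (auto simp: lookup_exponents in_keys_iff subset_iff)
    qed
    then show ?thesis by (simp add: scale_conv_mult mult_single)
  qed
  have "p = scale (1 / fact n) (symmetrize n p)"
    unfolding symmetrize_eq[OF assms]
    by (simp add: scale_conv_mult mult_single flip: mult.assoc)
  also have "symmetrize n p =
      symmetrize n (\<Sum>m\<in>Poly_Mapping.keys p. Poly_Mapping.single m (Poly_Mapping.lookup p m))"
    by (rule arg_cong) (rule mpoly_eq_sum_monomials)
  also have "\<dots> = (\<Sum>m\<in>Poly_Mapping.keys p.
      scale (Poly_Mapping.lookup p m) (monomial_sym n (Poly_Mapping.lookup m)))"
    unfolding symmetrize_sum monomial_sym_def
    by (intro sum.cong refl) (simp only: mon symmetrize_scale)
  finally show ?thesis
    by (simp add: scale_conv_mult sum_distrib_left mult_single flip: mult.assoc)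
qed

section \<open>The upper bound\<close>

lemma sum_lessThan_card_le: "finite A \<Longrightarrow> (\<Sum>i<card A. i) \<le> \<Sum>(A::nat set)"
proof (induction rule: finite_linorder_max_induct)
  case (insert b A)
  \<comment> \<open>The maximum \<open>b\<close> is at least the number of elements below
    it.\<close>
  then have "A \<subseteq> {..<b}" by auto
  then have "card A \<le> b" using subset_eq_atLeast0_lessThan_card[of A b] by (auto simp: lessThan_atLeast0)
  moreover have "b \<notin> A" using insert by auto
  ultimately show ?case using insert by simp
qed simp

text \<open>Abel summation: the weights e_i decrease and are nonnegative, and every partial sum
  \<open>D p\<close> of \<pi> i - i is nonnegative because p distinct naturals add up to at least 0
  + ... + (p - 1).\<close>

lemma rearrangement:
  fixes e \<pi> :: "nat \<Rightarrow> nat"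
  assumes "\<And>i j. i \<le> j \<Longrightarrow> j < q \<Longrightarrow> e j \<le> e i" "inj_on \<pi> {..<q}"
  shows "(\<Sum>i<q. int (e i) * (int (\<pi> i) - int i)) \<ge> 0"
proof -
  define D where "D q = (\<Sum>i<q. int (\<pi> i) - int i)" for q
  have D: "D p \<ge> 0" if "p \<le> q" for p
  proof -
    have "inj_on \<pi> {..<p}" using assms(2) that by (auto intro: inj_on_subset)
    then have "(\<Sum>i<p. i) \<le> (\<Sum>i<p. \<pi> i)"
      using sum_lessThan_card_le[of "\<pi> ` {..<p}"] by (simp add: card_image sum.reindex)
    then have "int (\<Sum>i<p. i) \<le> int (\<Sum>i<p. \<pi> i)" by (simp only: of_nat_le_iff)
    then show ?thesis unfolding D_def sum_subtractf by (simp only: of_nat_sum diff_ge_0_iff_ge)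
  qed
  \<comment> \<open>The strengthened form carries the last weight along, so that the next, smaller
    weight may replace it. For p = 0 the value \<open>e (0 - 1)\<close> is harmless since
    \<open>D 0\<close> is 0.\<close>
  have "(\<Sum>i<p. int (e i) * (int (\<pi> i) - int i)) \<ge> int (e (p - 1)) * D p" if "p \<le> q" for p
    using that
  proof (induction p)
    case 0
    then show ?case by (simp add: D_def)
  next
    case (Suc p)
    have "int (e p) * D p \<le> int (e (p - 1)) * D p"
      using assms(1)[of "p - 1" p] Suc.prems D[of p] by (intro mult_right_mono) auto
    moreover have "D (Suc p) = D p + (int (\<pi> p) - int p)" by (simp add: D_def)
    ultimately show ?case
      using Suc by (simp add: distrib_left)
  qed
  from this[of q] show ?thesis
    using mult_nonneg_nonneg[of "int (e (q - 1))" "D q"] D[of q] by linarith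
qed

text \<open>Squaring e_i + (\<pi> i - i) adds twice the rearrangement sum, which is nonnegative, and
  the sum of (\<pi> i - i) squared, which is positive for \<pi> \<noteq> id. The assumption r \<le>
  e r keeps the truncated difference e_i - i exact for i \<le> r.\<close>

lemma sum_squares_less:
  fixes e \<pi> :: "nat \<Rightarrow> nat"
  assumes anti: "\<And>i j. i \<le> j \<Longrightarrow> j < n \<Longrightarrow> e j \<le> e i"
    and r: "r < n" "r \<le> e r"
    and \<pi>: "\<pi> permutes {..r}" "\<pi> \<noteq> id"
    and f: "\<And>i. f i = (if i \<le> r then e i - i + \<pi> i else e i)"
  shows "(\<Sum>i<n. f i) = (\<Sum>i<n. e i)" "(\<Sum>i<n. (e i)\<^sup>2) < (\<Sum>i<n. (f i)\<^sup>2)"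
proof -
  have ge: "i \<le> e i" if "i \<le> r" for i using anti[of i r] r that by linarith
  have split: "{..<n} = {..r} \<union> {r<..<n}" "{..r} \<inter> {r<..<n} = {}" using r by auto
  have fi: "int (f i) = int (e i) + (int (\<pi> i) - int i)" if "i \<le> r" for i
    using ge[OF that] that by (simp add: f)
  have fi': "f i = e i" if "i \<in> {r<..<n}" for i using that by (simp add: f)
  have "(\<Sum>i\<le>r. int (\<pi> i)) = (\<Sum>i\<le>r. int i)"
    using sum.permute[OF \<pi>(1), of int] by (simp add: o_def)
  then have "(\<Sum>i\<le>r. int (f i)) = (\<Sum>i\<le>r. int (e i))"
    by (simp add: fi sum.distrib sum_subtractf)
  then have "int (\<Sum>i\<le>r. f i) = int (\<Sum>i\<le>r. e i)" by simp
  then have "(\<Sum>i\<le>r. f i) = (\<Sum>i\<le>r. e i)" by linarith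
  then show "(\<Sum>i<n. f i) = (\<Sum>i<n. e i)"
    unfolding split(1) by (simp add: sum.union_disjoint[OF _ _ split(2)] fi')
  have "(\<Sum>i\<le>r. int ((f i)\<^sup>2)) = (\<Sum>i\<le>r. int ((e i)\<^sup>2) +
      2 * (int (e i) * (int (\<pi> i) - int i)) + (int (\<pi> i) - int i)\<^sup>2)"
  proof (intro sum.cong refl)
    fix i assume "i \<in> {..r}"
    then have "int (f i) = int (e i) + (int (\<pi> i) - int i)" by (intro fi) simp
    then have "int ((f i)\<^sup>2) = (int (e i) + (int (\<pi> i) - int i))\<^sup>2" by (simp only: of_nat_power)
    then show "int ((f i)\<^sup>2) = int ((e i)\<^sup>2) + 2 * (int (e i) * (int (\<pi> i) - int i)) +
        (int (\<pi> i) - int i)\<^sup>2"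
      by (simp only: power2_sum of_nat_power mult.assoc)
  qed
  also have "\<dots> = (\<Sum>i\<le>r. int ((e i)\<^sup>2)) + 2 * (\<Sum>i\<le>r. int (e i) * (int (\<pi> i) - int i)) +
      (\<Sum>i\<le>r. (int (\<pi> i) - int i)\<^sup>2)"
    by (simp only: sum.distrib sum_distrib_left)
  also have "\<dots> > (\<Sum>i\<le>r. int ((e i)\<^sup>2))"
  proof -
    have "(\<Sum>i<Suc r. int (e i) * (int (\<pi> i) - int i)) \<ge> 0"
      using anti r permutes_inj_on[OF \<pi>(1)] by (intro rearrangement) auto
    then have "(\<Sum>i\<le>r. int (e i) * (int (\<pi> i) - int i)) \<ge> 0"
      by (simp only: lessThan_Suc_atMost)
    moreover obtain i where "\<pi> i \<noteq> i" using \<pi>(2) by (auto simp: fun_eq_iff)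
    then have "i \<le> r" using \<pi>(1) by (auto simp: permutes_def)
    then have "(\<Sum>i\<le>r. (int (\<pi> i) - int i)\<^sup>2) > 0"
      using \<open>\<pi> i \<noteq> i\<close> by (intro sum_pos2[of _ i]) auto
    ultimately show ?thesis by linarith
  qed
  finally have "int (\<Sum>i\<le>r. (e i)\<^sup>2) < int (\<Sum>i\<le>r. (f i)\<^sup>2)" by simp
  then have "(\<Sum>i\<le>r. (e i)\<^sup>2) < (\<Sum>i\<le>r. (f i)\<^sup>2)" by linarith
  then show "(\<Sum>i<n. (e i)\<^sup>2) < (\<Sum>i<n. (f i)\<^sup>2)"
    unfolding split(1) by (simp add: sum.union_disjoint[OF _ _ split(2)] fi')
qed

text \<open>In degree d this bounds all sums of squares by d squared, so that straightening
  terminates.\<close>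

lemma sum_squares_le_square: "finite A \<Longrightarrow> (\<Sum>i\<in>A. (f i)\<^sup>2) \<le> (\<Sum>i\<in>A. f i :: nat)\<^sup>2"
  by (induction rule: finite_induct) (auto simp: power2_sum)

lemma ex_sorting_permutation:
  fixes e :: "nat \<Rightarrow> nat"
  obtains \<tau> where "\<tau> permutes {..<n}" "\<And>i j. i \<le> j \<Longrightarrow> j < n \<Longrightarrow> e (\<tau> j) \<le> e (\<tau> i)"
proof -
  define xs where "xs = rev (sort (map e [0..<n]))"
  have len: "length xs = n" by (simp add: xs_def)
  have "mset xs = image_mset e (mset_set {..<n})"
    by (simp add: xs_def lessThan_atLeast0 flip: mset_upt)
  moreover have "mset xs = image_mset ((!) xs) (mset_set {..<n})"
    using len by (metis lessThan_atLeast0 map_nth mset_map mset_upt)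
  ultimately have "image_mset ((!) xs) (mset_set {..<n}) = image_mset e (mset_set {..<n})" by simp
  then obtain p where p: "p permutes {..<n}" "\<forall>i\<in>{..<n}. xs ! i = e (p i)"
    using image_mset_eq_implies_permutes[of "{..<n}"] by blast
  have "sorted_wrt (\<ge>) xs" unfolding xs_def sorted_wrt_rev by simp
  then have "xs ! j \<le> xs ! i" if "i \<le> j" "j < n" for i j
    using that len by (cases "i = j") (auto simp: sorted_wrt_iff_nth_less)
  then show ?thesis using p by (intro that[of p]) auto
qed

text \<open>Among the terms of $x^{e'} \det V(x_0, \dots, x_r)$ with $e'_i = e_i - i$, the diagonal one,
  which is $x^e$, has the smallest sum of squared exponents.\<close>

lemma monomial_sym_reduce:
  assumes anti: "\<And>i j. i \<le> j \<Longrightarrow> j < n \<Longrightarrow> e j \<le> e i"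
    and r: "r < n" "r \<le> e r"
  obtains F :: "(nat \<Rightarrow> nat) \<Rightarrow> nat \<Rightarrow> nat" and w :: "'k::comm_ring_1 mpoly" where
    "\<And>\<pi>. \<pi> permutes {..r} \<Longrightarrow> \<pi> \<noteq> id \<Longrightarrow> (\<Sum>i<n. F \<pi> i) = (\<Sum>i<n. e i)"
    "\<And>\<pi>. \<pi> permutes {..r} \<Longrightarrow> \<pi> \<noteq> id \<Longrightarrow> (\<Sum>i<n. (e i)\<^sup>2) < (\<Sum>i<n. (F \<pi> i)\<^sup>2)"
    "w \<in> hook_specht_ideal r" "w \<in> sym_polys n"
    "monomial_sym n e = w - (\<Sum>\<pi> | \<pi> permutes {..r} \<and> \<pi> \<noteq> id. signof \<pi> * monomial_sym n (F \<pi>))"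
proof -
  define e' where "e' i = (if i \<le> r then e i - i else e i)" for i
  \<comment> \<open>The exponent vector of the \<pi>-term of the product: the determinant
    contributes \<pi> i to the exponent of the variable i.\<close>
  define F where "F \<pi> i = (if i \<le> r then e i - i + \<pi> i else e i)" for \<pi> and i :: nat
  define p :: "'k mpoly" where
    "p = Poly_Mapping.single (exponents n e') 1 * det (vandermonde r (\<lambda>j. Var j))"
  have perm_eq: "{\<pi>. \<pi> permutes {0..<r + 1}} = {\<pi>. \<pi> permutes {..r}}"
    by (simp add: atLeast0LessThan lessThan_Suc_atMost)
  have ge: "i \<le> e i" if "i \<le> r" for i using anti[of i r] r that by linarith
  have Var_prod: "(\<Prod>i = 0..<r + 1. Var i ^ \<pi> i) =
      (Poly_Mapping.single (exponents n (\<lambda>i. if i \<le> r then \<pi> i else 0)) 1 :: 'k mpoly)" for \<pi>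
  proof -
    have Var_power: "Var i ^ k = (Poly_Mapping.single (Poly_Mapping.single i k) 1 :: 'k mpoly)" for i k
      by (induction k) (simp_all add: Var_def mult_single single_add[symmetric])
    have prod: "(\<Prod>i\<in>A. Poly_Mapping.single (g i) 1) = (Poly_Mapping.single (sum g A) 1 :: 'k mpoly)"
      if "finite A" for A and g :: "nat \<Rightarrow> nat \<Rightarrow>\<^sub>0 nat"
      using that by (induction A) (simp_all add: mult_single)
    have exps: "(\<Sum>i = 0..<r + 1. Poly_Mapping.single i (\<pi> i)) =
        exponents n (\<lambda>i. if i \<le> r then \<pi> i else 0)"
      unfolding exponents_def using r
      by (intro sum.mono_neutral_cong_left) auto
    show ?thesis unfolding Var_power prod[OF finite_atLeastLessThan] exps ..
  qed
  have "p = (\<Sum>\<pi> | \<pi> permutes {..r}. signof \<pi> * Poly_Mapping.single (exponents n (F \<pi>)) 1)"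
  proof -
    have "det (vandermonde r (\<lambda>j. Var j)) = (\<Sum>\<pi> | \<pi> permutes {..r}.
        signof \<pi> * (\<Prod>i = 0..<r + 1. Var i ^ \<pi> i) :: 'k mpoly)"
      unfolding perm_eq[symmetric]
      by (subst det_def'[of _ "r + 1"])
        (auto simp: vandermonde_def permutes_in_image intro!: sum.cong prod.cong 
          arg_cong2[where f="(*)"])
    then have "p = (\<Sum>\<pi> | \<pi> permutes {..r}. signof \<pi> * (Poly_Mapping.single (exponents n e') 1 *
        Poly_Mapping.single (exponents n (\<lambda>i. if i \<le> r then \<pi> i else 0)) 1))"
      unfolding p_def Var_prod by (simp only: sum_distrib_left mult.left_commute)
    also have "\<dots> = (\<Sum>\<pi> | \<pi> permutes {..r}.
        signof \<pi> * Poly_Mapping.single (exponents n (F \<pi>)) 1)"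
    proof -
      have "(\<lambda>i. e' i + (if i \<le> r then \<pi> i else 0)) = F \<pi>" for \<pi>
        by (auto simp: e'_def F_def)
      then show ?thesis by (simp add: mult_single exponents_add)
    qed
    finally show ?thesis .
  qed
  then have "symmetrize n p = (\<Sum>\<pi> | \<pi> permutes {..r}. signof \<pi> * monomial_sym n (F \<pi>))"
    by (simp add: symmetrize_sum symmetrize_signof monomial_sym_def)
  \<comment> \<open>The identity term is split off; it is \<open>monomial_sym n e\<close> because i
    \<le> e i for i \<le> r.\<close>
  also have "\<dots> = signof id * monomial_sym n (F id) +
      (\<Sum>\<pi>\<in>{\<pi>. \<pi> permutes {..r}} - {id}. signof \<pi> * monomial_sym n (F \<pi>))"
    by (rule sum.remove) (auto simp: finite_permutations permutes_id)
  also have "{\<pi>. \<pi> permutes {..r}} - {id} = {\<pi>. \<pi> permutes {..r} \<and> \<pi> \<noteq> id}" by auto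
  also have "signof id * monomial_sym n (F id) = (monomial_sym n e :: 'k mpoly)"
  proof -
    have "F id = e" using ge by (auto simp: F_def)
    then show ?thesis by simp
  qed
  finally have eq: "monomial_sym n e = symmetrize n p -
      (\<Sum>\<pi> | \<pi> permutes {..r} \<and> \<pi> \<noteq> id. signof \<pi> * monomial_sym n (F \<pi>))"
    unfolding eq_diff_eq by (rule sym)
  have "p \<in> hook_specht_ideal r"
    unfolding p_def by (rule ideal_mult) (rule vandermonde_in_ideal)
  moreover have "p \<in> polys_in n"
    unfolding \<open>p = (\<Sum>\<pi> | \<pi> permutes {..r}. _ \<pi>)\<close>
  proof (intro polys_in_sum)
    fix \<pi>
    show "signof \<pi> * Poly_Mapping.single (exponents n (F \<pi>)) 1 \<in> (polys_in n :: 'k mpoly set)"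
      using keys_exponents by (cases \<pi> rule: sign_cases) (auto simp: polys_in_def)
  qed
  ultimately have mem: "symmetrize n p \<in> hook_specht_ideal r" "symmetrize n p \<in> sym_polys n"
    by (auto intro: symmetrize_ideal symmetrize_sym_polys)
  have F: "(\<Sum>i<n. F \<pi> i) = (\<Sum>i<n. e i)" "(\<Sum>i<n. (e i)\<^sup>2) < (\<Sum>i<n. (F \<pi> i)\<^sup>2)"
    if "\<pi> permutes {..r}" "\<pi> \<noteq> id" for \<pi>
    by (rule sum_squares_less[where e = e and n = n and r = r and \<pi> = \<pi>];
        (rule anti r that F_def)?; assumption)+
  show ?thesis by (rule that[OF F mem eq])
qed

section \<open>Straightening modulo the ideal\<close>

definition decreasing :: "nat \<Rightarrow> (nat \<Rightarrow> nat) \<Rightarrow> bool" where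
  "decreasing n e \<longleftrightarrow> (\<forall>i j. i \<le> j \<longrightarrow> j < n \<longrightarrow> e j \<le> e i)"

lemma decreasingD: "decreasing n e \<Longrightarrow> i \<le> j \<Longrightarrow> j < n \<Longrightarrow> e j \<le> e i"
  by (simp add: decreasing_def)

text \<open>Parts are counted from 0, so \<open>e r\<close> is part number r + 1. For decreasing
  \<open>e\<close>, the condition e r < r says that the diagram does not contain the rectangle with
  r + 1 rows and r columns.\<close>

definition reduced_exponents :: "nat \<Rightarrow> nat \<Rightarrow> nat \<Rightarrow> (nat \<Rightarrow> nat) set" where
  "reduced_exponents r n d = {e. decreasing n e \<and> e r < r \<and> (\<Sum>i<n. e i) = d}"

text \<open>Unreduced exponents are rewritten by \<open>monomial_sym_reduce\<close> into exponents
  of the same degree with a larger sum of squares, which d squared bounds.\<close>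

lemma monomial_sym_span:
  fixes r n :: nat and W :: "'k::field_char_0 mpoly set"
  defines "W \<equiv> hook_specht_ideal r \<inter> sym_polys n"
  assumes n: "r < n"
    and B: "finite B" "\<And>e. e \<in> reduced_exponents r n d \<Longrightarrow> monomial_sym n e \<in> B"
    and e: "(\<Sum>i<n. e i) = d"
  shows "\<exists>c. monomial_sym n e - (\<Sum>b\<in>B. scale (c b) b) \<in> W"
proof -
  \<comment> \<open>The polynomials congruent to a combination of \<open>B\<close>. It is closed
    under addition and scaling and contains \<open>W\<close> and \<open>B\<close>, which is all that
    the induction needs.\<close>
  define R where "R = {u. \<exists>c. u - (\<Sum>b\<in>B. scale (c b) b) \<in> W}"
  have R_W: "u \<in> R" if "u \<in> W" for u
    unfolding R_def using that by (auto intro!: exI[of _ "\<lambda>_. 0"] simp: scale_conv_mult)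
  have W_scale: "scale a u \<in> W" if "u \<in> W" for a u
    using that by (auto simp: W_def sym_polys_scale ideal_scale)
  have R_add: "u + v \<in> R" if "u \<in> R" "v \<in> R" for u v
  proof -
    from that obtain c c' where "u - (\<Sum>b\<in>B. scale (c b) b) \<in> W" "v - (\<Sum>b\<in>B. scale (c' b) b) \<in> W"
      unfolding R_def by blast
    then have "(u - (\<Sum>b\<in>B. scale (c b) b)) + (v - (\<Sum>b\<in>B. scale (c' b) b)) \<in> W"
      unfolding W_def by (auto intro: ideal_add sym_polys_add)
    also have "(u - (\<Sum>b\<in>B. scale (c b) b)) + (v - (\<Sum>b\<in>B. scale (c' b) b)) =
        (u + v) - (\<Sum>b\<in>B. scale (c b + c' b) b)"
      by (simp add: scale_conv_mult single_add distrib_right sum.distrib)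
    finally show ?thesis unfolding R_def by (intro CollectI exI)
  qed
  have R_scale: "scale a u \<in> R" if u: "u \<in> R" for a u
  proof -
    obtain c where "u - (\<Sum>b\<in>B. scale (c b) b) \<in> W"
      using u unfolding R_def by blast
    then have "scale a (u - (\<Sum>b\<in>B. scale (c b) b)) \<in> W" by (rule W_scale)
    also have "scale a (u - (\<Sum>b\<in>B. scale (c b) b)) = scale a u - (\<Sum>b\<in>B. scale (a * c b) b)"
      by (simp add: scale_conv_mult right_diff_distrib sum_distrib_left mult_single flip: mult.assoc)
    finally show ?thesis unfolding R_def by (intro CollectI exI)
  qed
  have R_B: "b \<in> R" if "b \<in> B" for b
  proof -
    have "(\<Sum>x\<in>B. scale (if x = b then 1 else 0) x) = (\<Sum>x\<in>B. if x = b then b else 0)"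
      by (intro sum.cong) (auto simp: scale_conv_mult)
    also have "\<dots> = b" using B(1) that by simp
    finally have "b - (\<Sum>x\<in>B. scale (if x = b then 1 else 0) x) = 0" by simp
    also have "0 \<in> W" by (simp add: W_def ideal_zero)
    finally show ?thesis unfolding R_def by (intro CollectI exI)
  qed
  have R_sum: "sum f A \<in> R" if "\<And>i. i \<in> A \<Longrightarrow> f i \<in> R" for f and A :: "(nat \<Rightarrow> nat) set"
    using that
    by (induction A rule: infinite_finite_induct)
      (auto intro: R_add R_W simp: W_def ideal_zero)
  have "monomial_sym n e \<in> R"
    using e
  proof (induction e rule: measure_induct_rule[where f = "\<lambda>e. d\<^sup>2 - (\<Sum>i<n. (e i)\<^sup>2)"])
    case (less e)
    obtain \<tau> where \<tau>: "\<tau> permutes {..<n}" "\<And>i j. i \<le> j \<Longrightarrow> j < n \<Longrightarrow> e (\<tau> j) \<le> e (\<tau> i)"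
      by (rule ex_sorting_permutation[where n = n and e = e]) blast
    \<comment> \<open>Sorting changes neither the degree nor the sum of squares nor the symmetrized
      monomial.\<close>
    define e' where "e' i = e (\<tau> i)" for i
    have e': "(\<Sum>i<n. e' i) = d" "(\<Sum>i<n. (e' i)\<^sup>2) = (\<Sum>i<n. (e i)\<^sup>2)"
      using sum.permute[OF \<tau>(1), of e] sum.permute[OF \<tau>(1), of "\<lambda>i. (e i)\<^sup>2"] less.prems
      by (simp_all add: e'_def o_def)
    have eq: "monomial_sym n e = (monomial_sym n e' :: 'k mpoly)"
      using monomial_sym_permute[where 'k = 'k, OF \<tau>(1), of e] by (simp add: e'_def[abs_def])
    show ?case
    proof (cases "e' r < r")
      case True
      then have "e' \<in> reduced_exponents r n d"
        using \<tau>(2) e' by (auto simp: reduced_exponents_def decreasing_def e'_def)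
      then show ?thesis unfolding eq by (intro R_B B(2))
    next
      case False
      have anti: "\<And>i j. i \<le> j \<Longrightarrow> j < n \<Longrightarrow> e' j \<le> e' i" using \<tau>(2) by (simp add: e'_def)
      have "r \<le> e' r" using False by simp
      from monomial_sym_reduce[where e = e' and n = n and r = r, OF anti n this] obtain F and w :: "'k mpoly" where
        F: "\<And>\<pi>. \<pi> permutes {..r} \<Longrightarrow> \<pi> \<noteq> id \<Longrightarrow> (\<Sum>i<n. F \<pi> i) = (\<Sum>i<n. e' i)"
        "\<And>\<pi>. \<pi> permutes {..r} \<Longrightarrow> \<pi> \<noteq> id \<Longrightarrow> (\<Sum>i<n. (e' i)\<^sup>2) < (\<Sum>i<n. (F \<pi> i)\<^sup>2)"
        and w: "w \<in> hook_specht_ideal r" "w \<in> sym_polys n"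
        and exp: "monomial_sym n e' =
          w - (\<Sum>\<pi> | \<pi> permutes {..r} \<and> \<pi> \<noteq> id. signof \<pi> * monomial_sym n (F \<pi>))"
        by blast
      have "signof \<pi> * monomial_sym n (F \<pi>) \<in> R" if "\<pi> permutes {..r}" "\<pi> \<noteq> id" for \<pi>
      proof -
        \<comment> \<open>With this bound the truncated difference in the measure really
          drops.\<close>
        have "(\<Sum>i<n. (F \<pi> i)\<^sup>2) \<le> d\<^sup>2"
          using sum_squares_le_square[of "{..<n}" "F \<pi>"] F(1)[OF that] e' by simp
        then have "monomial_sym n (F \<pi>) \<in> R"
          using F(1,2)[OF that] e' by (intro less.IH) auto
        then show ?thesis
          using R_scale[of "monomial_sym n (F \<pi>)" "-1"]
          by (cases \<pi> rule: sign_cases) (auto simp: scale_conv_mult single_uminus)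
      qed
      then have "(\<Sum>\<pi> | \<pi> permutes {..r} \<and> \<pi> \<noteq> id. signof \<pi> * monomial_sym n (F \<pi>)) \<in> R"
        by (intro R_sum) auto
      then have "scale (-1) (\<Sum>\<pi> | \<pi> permutes {..r} \<and> \<pi> \<noteq> id. signof \<pi> * monomial_sym n (F \<pi>)) \<in> R"
        by (rule R_scale)
      moreover have "w \<in> R" using w by (intro R_W) (simp add: W_def)
      ultimately have "w + scale (-1) (\<Sum>\<pi> | \<pi> permutes {..r} \<and> \<pi> \<noteq> id. signof \<pi> * monomial_sym n (F \<pi>)) \<in> R"
        by (intro R_add)
      then show ?thesis unfolding eq exp by (simp add: scale_conv_mult single_uminus)
    qed
  qed
  then show ?thesis unfolding R_def by simp
qed

lemma sym_poly_span:
  fixes r n :: nat and W :: "'k::field_char_0 mpoly set"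
  defines "W \<equiv> hook_specht_ideal r \<inter> sym_polys n"
  assumes n: "r < n"
    and B: "finite B" "\<And>e. e \<in> reduced_exponents r n d \<Longrightarrow> monomial_sym n e \<in> B"
    and u: "u \<in> sym_polys n \<inter> homogeneous d"
  shows "\<exists>c. u - (\<Sum>b\<in>B. scale (c b) b) \<in> W"
proof -
  let ?K = "Poly_Mapping.keys u"
  let ?M = "\<lambda>m. monomial_sym n (Poly_Mapping.lookup m) :: 'k mpoly"
  have "\<exists>c. ?M m - (\<Sum>b\<in>B. scale (c b) b) \<in> W" if "m \<in> ?K" for m
  proof -
    have "Poly_Mapping.keys m \<subseteq> {..<n}" "total_degree m = d"
      using u that by (auto simp: sym_polys_def polys_in_def homogeneous_iff)
    then have deg: "(\<Sum>i<n. Poly_Mapping.lookup m i) = d"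
      using total_degree_superset[of "{..<n}" m] by simp
    have "\<exists>c. monomial_sym n e - (\<Sum>b\<in>B. scale (c b) b) \<in> W" if "(\<Sum>i<n. e i) = d" for e
      unfolding W_def
      using monomial_sym_span[where r = r and n = n and B = B and d = d and e = e, OF n B that] .
    from this[OF deg] show ?thesis .
  qed
  then have "\<forall>m\<in>?K. \<exists>c. ?M m - (\<Sum>b\<in>B. scale (c b) b) \<in> W" by (rule ballI)
  then have "\<exists>c. \<forall>m\<in>?K. ?M m - (\<Sum>b\<in>B. scale (c m b) b) \<in> W" by (rule bchoice)
  then obtain c where "\<forall>m\<in>?K. ?M m - (\<Sum>b\<in>B. scale (c m b) b) \<in> W" by (rule exE)
  note c = bspec[OF this]
  define a where "a m = Poly_Mapping.lookup u m / fact n" for m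
  have W_scale: "scale x v \<in> W" if "v \<in> W" for x v
    using that by (auto simp: W_def sym_polys_scale ideal_scale)
  have "(\<Sum>m\<in>?K. scale (a m) (?M m - (\<Sum>b\<in>B. scale (c m b) b))) \<in> W"
    using W_scale[OF c] unfolding W_def by (auto intro!: ideal_sum sym_polys_sum)
  also have "(\<Sum>m\<in>?K. scale (a m) (?M m - (\<Sum>b\<in>B. scale (c m b) b))) =
      (\<Sum>m\<in>?K. scale (a m) (?M m)) - (\<Sum>m\<in>?K. \<Sum>b\<in>B. scale (a m * c m b) b)"
    by (simp add: scale_conv_mult right_diff_distrib sum_subtractf sum_distrib_left mult_single
        flip: mult.assoc)
  also have "(\<Sum>m\<in>?K. scale (a m) (?M m)) = u"
    unfolding a_def by (rule sym_poly_conv_monomial_sym[symmetric]) (use u in auto)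
  also have "(\<Sum>m\<in>?K. \<Sum>b\<in>B. scale (a m * c m b) b) = (\<Sum>b\<in>B. scale (\<Sum>m\<in>?K. a m * c m b) b)"
  proof -
    have single_sum: "Poly_Mapping.single 0 (sum f A) = (\<Sum>m\<in>A. Poly_Mapping.single 0 (f m))"
      for f :: "(nat \<Rightarrow>\<^sub>0 nat) \<Rightarrow> 'k" and A
      by (induction A rule: infinite_finite_induct) (auto simp: single_add)
    show ?thesis
      by (subst sum.swap) (simp add: scale_conv_mult single_sum sum_distrib_right)
  qed
  finally show ?thesis by (intro exI)
qed

subsection \<open>Durfee rectangles\<close>

text \<open>The rectangle has area k (k + 1). To its right the columns have length at most k + 1,
  below it the rows have length at most k. Values outside these ranges are fixed to 0, so that each
  pair of multiplicity lists is represented once. Since n does not occur, the dimensions become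
  constant.\<close>

definition durfee_data :: "nat \<Rightarrow> nat \<Rightarrow> (nat \<times> (nat \<Rightarrow> nat) \<times> (nat \<Rightarrow> nat)) set" where
  "durfee_data r d = {(k, c, b). k < r \<and> (\<forall>j. j \<notin> {1..k+1} \<longrightarrow> c j = 0) \<and>
     (\<forall>j. j \<notin> {1..k} \<longrightarrow> b j = 0) \<and>
     k * (k + 1) + (\<Sum>j=1..k+1. j * c j) + (\<Sum>j=1..k. j * b j) = d}"

text \<open>A decreasing exponent vector with $e_k \ge k$ and $e_{k+1} \le k$ is cut into a rectangle with
  \<^term>\<open>k + 1\<close> rows and \<^term>\<open>k\<close> columns, the part to the right of it, in which column length
  \<^term>\<open>j\<close> occurs \<^term>\<open>c j\<close> times, and the part below it, in which row length \<^term>\<open>j\<close> occurs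
  \<^term>\<open>b j\<close> times.\<close>

definition durfee_size :: "(nat \<Rightarrow> nat) \<Rightarrow> nat" where
  "durfee_size e = (LEAST k. e (Suc k) \<le> k)"

text \<open>Rows are counted from 0: a column of length exactly j meets row j - 1 but not row j.
  Columns of length k + 1 are those of row k beyond the rectangle, hence e k - k.\<close>

definition durfee_columns :: "nat \<Rightarrow> (nat \<Rightarrow> nat) \<Rightarrow> nat \<Rightarrow> nat" where
  "durfee_columns k e j =
     (if j = k + 1 then e k - k else if 1 \<le> j \<and> j \<le> k then e (j - 1) - e j else 0)"

definition durfee_rows :: "nat \<Rightarrow> nat \<Rightarrow> (nat \<Rightarrow> nat) \<Rightarrow> nat \<Rightarrow> nat" where
  "durfee_rows n k e j = (if 1 \<le> j \<and> j \<le> k then card {i\<in>{k<..<n}. e i = j} else 0)"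

definition durfee :: "nat \<Rightarrow> (nat \<Rightarrow> nat) \<Rightarrow> nat \<times> (nat \<Rightarrow> nat) \<times> (nat \<Rightarrow> nat)" where
  "durfee n e = (durfee_size e, durfee_columns (durfee_size e) e, durfee_rows n (durfee_size e) e)"

text \<open>Writing r = r' + 1, the assumption e r < r makes r' a candidate for the least k, so k <
  r. Minimality at k - 1 gives k \<le> e k.\<close>

lemma durfee_size:
  assumes "e \<in> reduced_exponents r n d"
  defines "k \<equiv> durfee_size e"
  shows "k < r" "k \<le> e k" "e (Suc k) \<le> k"
proof -
  have "e r < r" using assms(1) by (simp add: reduced_exponents_def)
  then obtain r' where r': "r = Suc r'" "e (Suc r') \<le> r'" by (cases r) auto
  show "e (Suc k) \<le> k" unfolding k_def durfee_size_def using r'(2) by (rule LeastI)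
  have "k \<le> r'" unfolding k_def durfee_size_def using r'(2) by (rule Least_le)
  then show "k < r" by (simp add: r')
  show "k \<le> e k"
  proof (cases k)
    case (Suc k')
    then have "\<not> e (Suc k') \<le> k'"
      using not_less_Least[of k' "\<lambda>k. e (Suc k) \<le> k"] by (simp add: k_def durfee_size_def)
    then show ?thesis using Suc by simp
  qed simp
qed

lemma sum_rows:
  fixes e :: "nat \<Rightarrow> nat"
  assumes "finite A" "\<And>i. i \<in> A \<Longrightarrow> e i \<le> k"
  shows "(\<Sum>i\<in>A. e i) = (\<Sum>j=1..k. j * card {i\<in>A. e i = j})"
proof -
  have "(\<Sum>i\<in>A. e i) = (\<Sum>j=0..k. \<Sum>i | i \<in> A \<and> e i = j. e i)"
    using assms by (intro sum.group[symmetric]) auto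
  also have "\<dots> = (\<Sum>j=0..k. j * card {i\<in>A. e i = j})"
    by (intro sum.cong) (auto simp: mult.commute)
  also have "\<dots> = (\<Sum>j=1..k. j * card {i\<in>A. e i = j})"
    by (intro sum.mono_neutral_right) auto
  finally show ?thesis .
qed

text \<open>Abel summation: the first q rows are counted by columns, and the last term consists of
  the columns that reach row q.\<close>

lemma sum_columns:
  assumes "decreasing n e" "q < n"
  shows "(\<Sum>i<q. e i) = (\<Sum>j=1..q. j * (e (j - 1) - e j)) + q * e q"
  using assms(2)
proof (induction q)
  case (Suc q)
  have "e (Suc q) \<le> e q" using Suc.prems by (intro decreasingD[OF assms(1)]) auto
  then have "Suc q * (e q - e (Suc q)) + Suc q * e (Suc q) = Suc q * e q"
    unfolding add_mult_distrib2[symmetric] by simp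
  then show ?case using Suc by simp
qed simp

lemma durfee_mem:
  assumes e: "e \<in> reduced_exponents r n d" and n: "r < n"
  shows "durfee n e \<in> durfee_data r d"
proof -
  define k where "k = durfee_size e"
  note k = durfee_size[OF e, folded k_def]
  have anti: "decreasing n e" and d: "(\<Sum>i<n. e i) = d"
    using e by (auto simp: reduced_exponents_def)
  \<comment> \<open>Rows 0 to k meet the rectangle; row k is separate because
    \<open>sum_columns\<close> treats the rows before it.\<close>
  have split: "{..<n} = {..<k} \<union> {k} \<union> {k<..<n}" using k n by auto
  have "d = (\<Sum>i<k. e i) + e k + (\<Sum>i\<in>{k<..<n}. e i)"
    unfolding d[symmetric] split
    by (subst sum.union_disjoint; (simp add: sum.union_disjoint)?) auto
  also have "(\<Sum>i\<in>{k<..<n}. e i) = (\<Sum>j=1..k. j * durfee_rows n k e j)"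
  proof -
    have "e i \<le> k" if "i \<in> {k<..<n}" for i
      using decreasingD[OF anti, of "Suc k" i] that k by auto
    then show ?thesis
      by (subst sum_rows[of _ _ k]) (auto simp: durfee_rows_def intro!: sum.cong)
  qed
  also have "(\<Sum>i<k. e i) + e k = k * (k + 1) + (\<Sum>j=1..k+1. j * durfee_columns k e j)"
  proof -
    have "(\<Sum>j=1..k+1. j * durfee_columns k e j) =
        (\<Sum>j=1..k. j * (e (j - 1) - e j)) + (k + 1) * (e k - k)"
    proof -
      have "(\<Sum>j=1..k. j * durfee_columns k e j) = (\<Sum>j=1..k. j * (e (j - 1) - e j))"
        by (intro sum.cong) (auto simp: durfee_columns_def)
      then show ?thesis by (simp add: durfee_columns_def)
    qed
    moreover have "(k + 1) * (e k - k) + k * (k + 1) = (k + 1) * e k"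
      unfolding mult.commute[of k] add_mult_distrib2[symmetric] using k(2) by simp
    moreover have "(k + 1) * e k = k * e k + e k" by simp
    ultimately show ?thesis using sum_columns[OF anti, of k] k n by simp
  qed
  finally show ?thesis
    using k by (auto simp: durfee_def durfee_data_def k_def[symmetric] durfee_rows_def durfee_columns_def)
qed

lemma card_fibre_split:
  fixes k n :: nat
  assumes "k < n"
  shows "card {i\<in>{..<n}. e i = v} = card {i\<in>{..k}. e i = v} + card {i\<in>{k<..<n}. e i = v}"
proof -
  have "{i\<in>{..<n}. e i = v} = {i\<in>{..k}. e i = v} \<union> {i\<in>{k<..<n}. e i = v}"
    using assms by (auto simp: linorder_not_less)
  moreover have "{i\<in>{..k}. e i = v} \<inter> {i\<in>{k<..<n}. e i = v} = {}" by auto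
  moreover have "finite {i\<in>{..k}. e i = v}" "finite {i\<in>{k<..<n}. e i = v}"
    by (auto intro: finite_subset[of _ "{..k}"] finite_subset[of _ "{k<..<n}"])
  ultimately show ?thesis by (simp only: card_Un_disjoint)
qed

text \<open>The data determine the multiset of the n exponents, and \<open>monomial_sym\<close>
  depends on nothing else.\<close>

lemma durfee_eq_imp_monomial_sym_eq:
  assumes e: "e \<in> reduced_exponents r n d" and f: "f \<in> reduced_exponents r n d"
    and n: "r < n" and eq: "durfee n e = durfee n f"
  shows "monomial_sym n e = (monomial_sym n f :: 'k::comm_ring_1 mpoly)"
proof -
  define k where "k = durfee_size e"
  have k': "durfee_size f = k" using eq by (simp add: durfee_def k_def)
  note ke = durfee_size[OF e, folded k_def] and kf = durfee_size[OF f, unfolded k']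
  have cols: "durfee_columns k e j = durfee_columns k f j"
    and rows: "durfee_rows n k e j = durfee_rows n k f j" for j
    using eq by (simp_all add: durfee_def k' k_def[symmetric])
  have anti: "decreasing n e" "decreasing n f"
    using e f by (auto simp: reduced_exponents_def)
  \<comment> \<open>Downward from row k: \<open>durfee_columns\<close> gives e k first and then the
    differences e i - e (i + 1).\<close>
  have top: "e i = f i" if "i \<le> k" for i
    using that
  proof (induction rule: inc_induct)
    case base
    show ?case using cols[of "k + 1"] ke kf by (simp add: durfee_columns_def)
  next
    case (step i)
    then have "Suc i < n" using ke n by simp
    then have "e (Suc i) \<le> e i" "f (Suc i) \<le> f i"
      using decreasingD[OF anti(1), of i "Suc i"] decreasingD[OF anti(2), of i "Suc i"] by simp_all
    then show ?case
      using cols[of "Suc i"] step by (simp add: durfee_columns_def)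
  qed
  have low: "e i \<le> k" "f i \<le> k" if "i \<in> {k<..<n}" for i
    using decreasingD[OF anti(1), of "Suc k" i] decreasingD[OF anti(2), of "Suc k" i] that ke kf
    by auto
  have rows_pos: "card {i\<in>{k<..<n}. e i = v} = card {i\<in>{k<..<n}. f i = v}" if "v > 0" for v
  proof (cases "v \<le> k")
    case True
    then show ?thesis using rows[of v] that by (simp add: durfee_rows_def)
  next
    case False
    then have "{i\<in>{k<..<n}. e i = v} = {}" "{i\<in>{k<..<n}. f i = v} = {}"
      using low by fastforce+
    then show ?thesis by (simp only:)
  qed
  \<comment> \<open>Rows of length 0 are not recorded in the data; their number is what remains of
    the fixed number of rows below the rectangle.\<close>
  have total: "card {k<..<n} = card {i\<in>{k<..<n}. g i = 0} + (\<Sum>j=1..k. card {i\<in>{k<..<n}. g i = j})"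
    if "\<And>i. i \<in> {k<..<n} \<Longrightarrow> g i \<le> k" for g :: "nat \<Rightarrow> nat"
  proof -
    have "card {k<..<n} = (\<Sum>j=0..k. \<Sum>i | i \<in> {k<..<n} \<and> g i = j. 1)"
      unfolding card_eq_sum using that by (intro sum.group[symmetric]) auto
    then show ?thesis by (simp add: sum.atLeast_Suc_atMost)
  qed
  have "(\<Sum>j=1..k. card {i\<in>{k<..<n}. e i = j}) = (\<Sum>j=1..k. card {i\<in>{k<..<n}. f i = j})"
    by (intro sum.cong refl rows_pos) simp
  then have "card {i\<in>{k<..<n}. e i = 0} = card {i\<in>{k<..<n}. f i = 0}"
    using total[of e] total[of f] low by auto
  then have rows_all: "card {i\<in>{k<..<n}. e i = v} = card {i\<in>{k<..<n}. f i = v}" for v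
    using rows_pos[of v] by (cases "v = 0") auto
  have "{i\<in>{..k}. e i = v} = {i\<in>{..k}. f i = v}" for v using top by auto
  then have cards: "card {i\<in>{..<n}. e i = v} = card {i\<in>{..<n}. f i = v}" for v
    unfolding card_fibre_split[OF less_trans[OF ke(1) n]] by (simp only: rows_all)
  have "image_mset e (mset_set {..<n}) = image_mset f (mset_set {..<n})"
  proof (intro multiset_eqI)
    have "count (image_mset g (mset_set {..<n})) v = card {i\<in>{..<n}. g i = v}"
      for g :: "nat \<Rightarrow> nat" and v
    proof -
      have "g -` {v} \<inter> {..<n} = {i\<in>{..<n}. g i = v}" by auto
      then show ?thesis by (simp add: count_image_mset)
    qed
    then show "count (image_mset e (mset_set {..<n})) v = count (image_mset f (mset_set {..<n})) v" for v
      using cards[of v] by (simp only:)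
  qed
  then obtain p where "p permutes {..<n}" "\<forall>i\<in>{..<n}. e i = f (p i)"
    using image_mset_eq_implies_permutes[of "{..<n}"] by blast
  then show ?thesis
    using monomial_sym_permute[where 'k = 'k, of p n f]
      monomial_sym_cong[where 'a = 'k, of n e "\<lambda>i. f (p i)"] by simp
qed

lemma spanning_set:
  assumes n: "r < n" and fin: "finite (durfee_data r d)"
  obtains B :: "'k::field_char_0 mpoly set" where "finite B" "B \<subseteq> sym_polys n \<inter> homogeneous d"
    "card B \<le> card (durfee_data r d)"
    "\<And>u. u \<in> sym_polys n \<inter> homogeneous d \<Longrightarrow>
      \<exists>c. u - (\<Sum>b\<in>B. scale (c b) b) \<in> hook_specht_ideal r \<inter> sym_polys n"
proof -
  let ?E = "reduced_exponents r n d"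
  \<comment> \<open>One representative exponent vector per datum. It shows that the spanning set is
    the image of a subset of \<open>durfee_data r d\<close>, which bounds its cardinality.\<close>
  define h :: "_ \<Rightarrow> 'k mpoly" where
    "h t = monomial_sym n (SOME e. e \<in> ?E \<and> durfee n e = t)" for t
  have h: "h (durfee n e) = monomial_sym n e" if "e \<in> ?E" for e
  proof -
    let ?e = "SOME e'. e' \<in> ?E \<and> durfee n e' = durfee n e"
    have "?e \<in> ?E \<and> durfee n ?e = durfee n e" by (rule someI[of _ e]) (use that in auto)
    then show ?thesis unfolding h_def using that n by (intro durfee_eq_imp_monomial_sym_eq) auto
  qed
  define B :: "'k mpoly set" where "B = monomial_sym n ` ?E"
  have "B = h ` (durfee n ` ?E)" unfolding B_def image_image using h by auto
  moreover have sub: "durfee n ` ?E \<subseteq> durfee_data r d" using durfee_mem[OF _ n] by auto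
  ultimately have "finite B" "card B \<le> card (durfee n ` ?E)"
    using finite_subset[OF sub fin] card_image_le by auto
  moreover have "card (durfee n ` ?E) \<le> card (durfee_data r d)" by (intro card_mono fin sub)
  moreover have "B \<subseteq> sym_polys n \<inter> homogeneous d"
    unfolding B_def using monomial_sym_mem[of _ n d] by (auto simp: reduced_exponents_def)
  ultimately show ?thesis
    using sym_poly_span[OF n, of B d] by (intro that[of B]) (auto simp: B_def)
qed

section \<open>Polynomial functions\<close>

text \<open>A predicate on functions, so that an expression in the multiplicities can be treated as
  a polynomial in one of them while the others stay fixed.\<close>

definition poly_fun :: "nat \<Rightarrow> ('k::field \<Rightarrow> 'k) \<Rightarrow> bool" where
  "poly_fun D f \<longleftrightarrow> (\<exists>q. degree q \<le> D \<and> (\<forall>t. f t = poly q t))"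

lemma poly_fun_const: "poly_fun 0 (\<lambda>_. a)"
  unfolding poly_fun_def by (rule exI[of _ "[:a:]"]) simp

lemma poly_fun_affine: "poly_fun 1 (\<lambda>t. a + t * b)"
  unfolding poly_fun_def by (rule exI[of _ "[:a, b:]"]) auto

lemma poly_fun_mono: "poly_fun D f \<Longrightarrow> D \<le> D' \<Longrightarrow> poly_fun D' f"
  unfolding poly_fun_def by (meson le_trans)

lemma poly_fun_add:
  assumes "poly_fun D f" "poly_fun D g"
  shows "poly_fun D (\<lambda>t. f t + g t)"
proof -
  obtain p q where "degree p \<le> D" "\<forall>t. f t = poly p t" "degree q \<le> D" "\<forall>t. g t = poly q t"
    using assms unfolding poly_fun_def by blast
  then show ?thesis
    unfolding poly_fun_def by (intro exI[of _ "p + q"]) (auto intro: degree_add_le)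
qed

lemma poly_fun_mult:
  assumes "poly_fun D f" "poly_fun D' g"
  shows "poly_fun (D + D') (\<lambda>t. f t * g t)"
proof -
  obtain p q where "degree p \<le> D" "\<forall>t. f t = poly p t" "degree q \<le> D'" "\<forall>t. g t = poly q t"
    using assms unfolding poly_fun_def by blast
  then show ?thesis
    unfolding poly_fun_def using degree_mult_le[of p q] by (intro exI[of _ "p * q"]) auto
qed

lemma poly_fun_sum:
  "finite A \<Longrightarrow> (\<And>i. i \<in> A \<Longrightarrow> poly_fun D (f i)) \<Longrightarrow> poly_fun D (\<lambda>t. \<Sum>i\<in>A. f i t)"
  by (induction A rule: finite_induct)
    (auto intro: poly_fun_add poly_fun_mono[OF poly_fun_const])

lemma poly_fun_prod:
  "finite A \<Longrightarrow> (\<And>i. i \<in> A \<Longrightarrow> poly_fun (D i) (f i)) \<Longrightarrow>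
    poly_fun (\<Sum>i\<in>A. D i) (\<lambda>t. \<Prod>i\<in>A. f i t)"
  by (induction A rule: finite_induct) (auto intro: poly_fun_const poly_fun_mult)

lemma poly_fun_power: "poly_fun D f \<Longrightarrow> poly_fun (k * D) (\<lambda>t. f t ^ k)"
  by (induction k) (auto intro: poly_fun_const poly_fun_mult)

lemma poly_fun_eq_zero:
  assumes "poly_fun D f" "finite S" "card S > D" "\<And>t. t \<in> S \<Longrightarrow> f t = 0"
  shows "f t = 0"
proof -
  obtain q where q: "degree q \<le> D" "\<And>t. f t = poly q t"
    using assms(1) unfolding poly_fun_def by blast
  have "q = 0"
  proof (rule ccontr)
    assume "q \<noteq> 0"
    then have "card S \<le> card {t. poly q t = 0}"
      using assms(4) q(2) by (intro card_mono poly_roots_finite) auto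
    also have "\<dots> \<le> degree q" using \<open>q \<noteq> 0\<close> by (rule card_poly_roots_bound)
    finally show False using q(1) assms(3) by simp
  qed
  then show ?thesis using q(2) by simp
qed

text \<open>One coordinate at a time: with the others in \<open>S\<close>, F has more than D zeros
  in coordinate i, hence vanishes for every value there, and the induction proceeds with the
  remaining coordinates.\<close>

lemma vanishing_on_grid:
  fixes F :: "(nat \<Rightarrow> 'k::field) \<Rightarrow> 'k"
  assumes poly: "\<And>m i. i \<in> J \<Longrightarrow> poly_fun D (\<lambda>t. F (m(i := t)))"
    and S: "finite S" "card S > D"
    and J: "finite J" and F: "\<And>m. (\<forall>i\<in>J. m i \<in> S) \<Longrightarrow> F m = 0"
  shows "F m = 0"
  using J poly F
proof (induction J arbitrary: m rule: finite_induct)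
  case (insert i J)
  have "F m = 0" if "\<forall>j\<in>J. m j \<in> S" for m
  proof -
    have "F (m(i := t)) = 0" if "t \<in> S" for t
      using that \<open>\<forall>j\<in>J. m j \<in> S\<close> insert.hyps by (intro insert.prems) auto
    then have "F (m(i := m i)) = 0"
      using poly_fun_eq_zero[OF insert.prems(1)[of i m] S] by blast
    then show ?thesis by simp
  qed
  then show ?case
    using insert.prems(1) by (rule insert.IH[rotated]) (simp_all only: insert_iff simp_thms)
qed simp

text \<open>Over an infinite field distinct monomials are independent functions. The exponents
  \<open>E s\<close> may coincide for different s, so the conclusion concerns the total coefficient
  of a monomial.\<close>

lemma monomial_functions_independent:
  fixes g :: "'s \<Rightarrow> 'k::field_char_0" and q :: nat
  assumes "finite S" "\<And>x. (\<Sum>s\<in>S. g s * (\<Prod>i<q. x i ^ E s i)) = 0"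
  shows "(\<Sum>s | s \<in> S \<and> (\<forall>i<q. E s i = e i). g s) = 0"
  using assms
proof (induction q arbitrary: S)
  case (Suc q)
  have "(\<Sum>s | s \<in> S \<and> E s q = e q. g s * (\<Prod>i<q. x i ^ E s i)) = 0" for x
  proof -
    \<comment> \<open>The relation as a polynomial in the last variable; its coefficient at
      \<open>e q\<close> is a relation in the other variables.\<close>
    define p where "p = (\<Sum>s\<in>S. monom (g s * (\<Prod>i<q. x i ^ E s i)) (E s q))"
    have "poly p t = 0" for t
    proof -
      have "poly p t = (\<Sum>s\<in>S. g s * (\<Prod>i<Suc q. (x(q := t)) i ^ E s i))"
        unfolding p_def poly_sum poly_monom
      proof (rule sum.cong[OF refl])
        fix s
        have "(\<Prod>i<q. (x(q := t)) i ^ E s i) = (\<Prod>i<q. x i ^ E s i)"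
          by (intro prod.cong refl) simp
        then show "g s * (\<Prod>i<q. x i ^ E s i) * t ^ E s q = g s * (\<Prod>i<Suc q. (x(q := t)) i ^ E s i)"
          by (simp only: prod.lessThan_Suc fun_upd_same mult.assoc)
      qed
      then show ?thesis by (simp only: Suc.prems(2))
    qed
    then have "p = 0" by (simp add: poly_all_0_iff_0[symmetric])
    then have "coeff p (e q) = 0" by simp
    then show ?thesis
      using Suc.prems(1)
      by (simp add: p_def coeff_sum sum.inter_filter)
  qed
  then have "(\<Sum>s | s \<in> {s \<in> S. E s q = e q} \<and> (\<forall>i<q. E s i = e i). g s) = 0"
    using Suc.prems(1) by (intro Suc.IH) auto
  also have "{s. s \<in> {s \<in> S. E s q = e q} \<and> (\<forall>i<q. E s i = e i)} =
      {s. s \<in> S \<and> (\<forall>i<Suc q. E s i = e i)}"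
    by (auto simp: less_Suc_eq)
  finally show ?case .
qed simp

section \<open>Vandermonde matrices over a field\<close>

text \<open>A kernel vector is the coefficient vector of a polynomial of degree at most k with k + 1
  roots.\<close>

lemma det_vandermonde_nonzero:
  fixes y :: "nat \<Rightarrow> 'k::field"
  assumes "inj_on y {..k}"
  shows "det (vandermonde k y) \<noteq> 0"
proof
  have carr: "vandermonde k y \<in> carrier_mat (k + 1) (k + 1)" by (simp add: vandermonde_def)
  assume "det (vandermonde k y) = 0"
  then obtain v where v: "v \<in> carrier_vec (k + 1)" "v \<noteq> 0\<^sub>v (k + 1)"
      "vandermonde k y *\<^sub>v v = 0\<^sub>v (k + 1)"
    using det_0_iff_vec_prod_zero_field[OF carr] by blast
  define p where "p = (\<Sum>l\<le>k. monom (v $ l) l)"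
  have "poly p (y i) = 0" if "i \<le> k" for i
  proof -
    have "poly p (y i) = (\<Sum>l\<le>k. y i ^ l * v $ l)"
      by (simp add: p_def poly_sum poly_monom mult.commute)
    also have "\<dots> = (\<Sum>l = 0..<k + 1. y i ^ l * v $ l)"
      by (simp only: atLeast0LessThan Suc_eq_plus1[symmetric] lessThan_Suc_atMost)
    also have "\<dots> = (vandermonde k y *\<^sub>v v) $ i"
      using that v(1) by (simp add: vandermonde_def scalar_prod_def)
    finally show ?thesis using that v(3) by simp
  qed
  moreover have "degree p \<le> k"
    unfolding p_def by (intro degree_sum_le order_trans[OF degree_monom_le]) auto
  ultimately have roots: "y ` {..k} \<subseteq> {t. poly p t = 0}" and deg: "degree p \<le> k" by auto
  have "coeff p l = v $ l" if "l \<le> k" for l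
    using that by (simp add: p_def coeff_sum)
  moreover have "p = 0"
  proof (rule ccontr)
    assume "p \<noteq> 0"
    then have "card (y ` {..k}) \<le> card {t. poly p t = 0}"
      by (intro card_mono poly_roots_finite roots)
    also have "\<dots> \<le> degree p" using \<open>p \<noteq> 0\<close> by (rule card_poly_roots_bound)
    finally show False using deg assms by (simp add: card_image)
  qed
  ultimately have "v = 0\<^sub>v (k + 1)" using v(1) by (intro eq_vecI) auto
  then show False using v(2) by simp
qed

text \<open>The transposed Vandermonde system is invertible, so weights in the field realize any
  prescribed moments of order 0 to k.\<close>

lemma solve_moments:
  fixes y :: "nat \<Rightarrow> 'k::field"
  assumes "inj_on y {..k}"
  obtains m where "\<And>l. l \<le> k \<Longrightarrow> (\<Sum>i\<le>k. m i * y i ^ l) = P l"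
proof -
  let ?A = "transpose_mat (vandermonde k y)"
  have V: "vandermonde k y \<in> carrier_mat (k + 1) (k + 1)" by (simp add: vandermonde_def)
  then have A: "?A \<in> carrier_mat (k + 1) (k + 1)" by simp
  have "det ?A \<noteq> 0" using det_vandermonde_nonzero[OF assms] by (simp add: det_transpose[OF V])
  from det_non_zero_imp_unit[OF A this]
  obtain B where B: "B \<in> carrier_mat (k + 1) (k + 1)" "?A * B = 1\<^sub>m (k + 1)"
    by (auto simp: Units_def ring_mat_def)
  define m where "m = B *\<^sub>v vec (k + 1) P"
  have "?A *\<^sub>v m = vec (k + 1) P"
    unfolding m_def using A B by (simp flip: assoc_mult_mat_vec)
  moreover have "m \<in> carrier_vec (k + 1)" using B by (simp add: m_def)
  ultimately have "(\<Sum>i\<le>k. m $ i * y i ^ l) = P l" if "l \<le> k" for l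
  proof -
    have "(?A *\<^sub>v m) $ l = (\<Sum>i = 0..<k + 1. m $ i * y i ^ l)"
      using that \<open>m \<in> carrier_vec (k + 1)\<close>
      by (simp add: vandermonde_def scalar_prod_def mult.commute)
    also have "\<dots> = (\<Sum>i\<le>k. m $ i * y i ^ l)"
      by (simp only: atLeast0LessThan Suc_eq_plus1[symmetric] lessThan_Suc_atMost)
    finally have "(?A *\<^sub>v m) $ l = (\<Sum>i\<le>k. m $ i * y i ^ l)" .
    then show ?thesis using that \<open>?A *\<^sub>v m = vec (k + 1) P\<close> by simp
  qed
  then show ?thesis by (rule that)
qed

text \<open>Its determinant is an alternant: for strictly decreasing exponents, up to sign, a Schur
  polynomial times the Vandermonde determinant.\<close>

definition generalized_vandermonde :: "nat \<Rightarrow> (nat \<Rightarrow> nat) \<Rightarrow> (nat \<Rightarrow> 'k::comm_ring_1) \<Rightarrow> 'k mat" where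
  "generalized_vandermonde k a y = mat (k + 1) (k + 1) (\<lambda>(i, j). y i ^ a j)"

lemma det_generalized_vandermonde:
  "det (generalized_vandermonde k a y) =
    (\<Sum>\<pi> | \<pi> permutes {..k}. signof \<pi> * (\<Prod>i<k+1. y i ^ a (\<pi> i)))"
proof -
  have carr: "generalized_vandermonde k a y \<in> carrier_mat (k + 1) (k + 1)"
    by (simp add: generalized_vandermonde_def)
  have "(\<Prod>i = 0..<k + 1. generalized_vandermonde k a y $$ (i, \<pi> i)) = (\<Prod>i<k+1. y i ^ a (\<pi> i))"
    if "\<pi> permutes {0..<k + 1}" for \<pi>
    unfolding atLeast0LessThan
  proof (rule prod.cong[OF refl])
    fix i assume "i \<in> {..<k + 1}"
    then have "i < k + 1" "\<pi> i < k + 1" using permutes_in_image[OF that, of i] by auto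
    then show "generalized_vandermonde k a y $$ (i, \<pi> i) = y i ^ a (\<pi> i)"
      by (simp add: generalized_vandermonde_def)
  qed
  then have "det (generalized_vandermonde k a y) =
      (\<Sum>\<pi> | \<pi> permutes {0..<k + 1}. signof \<pi> * (\<Prod>i<k+1. y i ^ a (\<pi> i)))"
    unfolding det_def'[OF carr] by (intro sum.cong refl) (simp only: mem_Collect_eq)
  then show ?thesis by (simp only: atLeast0LessThan Suc_eq_plus1[symmetric] lessThan_Suc_atMost)
qed

lemma det_generalized_vandermonde_eq_0:
  assumes "\<not> inj_on y {..k}"
  shows "det (generalized_vandermonde k a y) = 0"
proof -
  obtain i j where "i \<le> k" "j \<le> k" "i \<noteq> j" "y i = y j"
    using assms by (auto simp: inj_on_def)
  then show ?thesis
    by (intro det_identical_rows[of _ "k + 1" i j])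
      (auto simp: generalized_vandermonde_def intro!: eq_vecI)
qed

text \<open>The matrix of weighted power sums factors as the transpose of \<open>A\<close> times the
  Vandermonde matrix, where row i of \<open>A\<close> has the common factor m_i.\<close>

lemma det_hankel:
  fixes y :: "nat \<Rightarrow> 'k::comm_ring_1"
  shows "det (mat (k + 1) (k + 1) (\<lambda>(j, l). \<Sum>i\<le>k. m i * y i ^ (a j + l))) =
    (\<Prod>i\<le>k. m i) * det (generalized_vandermonde k a y) * det (vandermonde k y)"
proof -
  define A where "A = mat (k + 1) (k + 1) (\<lambda>(i, j). m i * y i ^ a j)"
  have A: "A \<in> carrier_mat (k + 1) (k + 1)" by (simp add: A_def)
  have V: "vandermonde k y \<in> carrier_mat (k + 1) (k + 1)" by (simp add: vandermonde_def)
  have "mat (k + 1) (k + 1) (\<lambda>(j, l). \<Sum>i\<le>k. m i * y i ^ (a j + l)) =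
      transpose_mat A * vandermonde k y"
  proof (rule eq_matI)
    fix j l assume "j < dim_row (transpose_mat A * vandermonde k y)"
      "l < dim_col (transpose_mat A * vandermonde k y)"
    then have jl: "j < k + 1" "l < k + 1" using A V by auto
    have "(transpose_mat A * vandermonde k y) $$ (j, l) =
        (\<Sum>i\<in>{0..<k + 1}. A $$ (i, j) * vandermonde k y $$ (i, l))"
    proof -
      have dims: "dim_row A = k + 1" "dim_col A = k + 1" "dim_row (vandermonde k y) = k + 1"
          "dim_col (vandermonde k y) = k + 1"
        using A V by auto
      have "(transpose_mat A * vandermonde k y) $$ (j, l) = col A j \<bullet> col (vandermonde k y) l"
        using jl dims by (simp only: index_mult_mat row_transpose index_transpose_mat)
      also have "\<dots> = (\<Sum>i\<in>{0..<k + 1}. col A j $ i * col (vandermonde k y) l $ i)"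
        using dims by (simp only: scalar_prod_def dim_col)
      also have "\<dots> = (\<Sum>i\<in>{0..<k + 1}. A $$ (i, j) * vandermonde k y $$ (i, l))"
        using dims jl by (intro sum.cong refl) (simp only: index_col atLeastLessThan_iff)
      finally show ?thesis .
    qed
    also have "\<dots> = (\<Sum>i\<in>{0..<k + 1}. m i * y i ^ (a j + l))"
    proof (rule sum.cong[OF refl])
      fix i assume "i \<in> {0..<k + 1}"
      then have "A $$ (i, j) = m i * y i ^ a j" "vandermonde k y $$ (i, l) = y i ^ l"
        using jl by (simp_all add: A_def vandermonde_def)
      then show "A $$ (i, j) * vandermonde k y $$ (i, l) = m i * y i ^ (a j + l)"
        by (simp only: power_add mult.assoc)
    qed
    also have "\<dots> = (\<Sum>i\<le>k. m i * y i ^ (a j + l))"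
      by (simp only: atLeast0LessThan Suc_eq_plus1[symmetric] lessThan_Suc_atMost)
    finally show "mat (k + 1) (k + 1) (\<lambda>(j, l). \<Sum>i\<le>k. m i * y i ^ (a j + l)) $$ (j, l) =
        (transpose_mat A * vandermonde k y) $$ (j, l)"
      using jl by simp
  qed (simp_all add: A_def vandermonde_def)
  then have "det (mat (k + 1) (k + 1) (\<lambda>(j, l). \<Sum>i\<le>k. m i * y i ^ (a j + l))) =
      det A * det (vandermonde k y)"
    using det_mult[of "transpose_mat A" "k + 1" "vandermonde k y"] A V by (simp add: det_transpose[OF A])
  also have "det A = (\<Prod>i\<le>k. m i) * det (generalized_vandermonde k a y)"
  proof -
    have "(\<Prod>i = 0..<k + 1. A $$ (i, \<pi> i)) = (\<Prod>i\<le>k. m i) * (\<Prod>i<k+1. y i ^ a (\<pi> i))"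
      if "\<pi> permutes {0..<k + 1}" for \<pi>
    proof -
      have "(\<Prod>i = 0..<k + 1. A $$ (i, \<pi> i)) = (\<Prod>i<k+1. m i * y i ^ a (\<pi> i))"
        unfolding atLeast0LessThan
      proof (rule prod.cong[OF refl])
        fix i assume "i \<in> {..<k + 1}"
        then have "i < k + 1" "\<pi> i < k + 1" using permutes_in_image[OF that, of i] by auto
        then show "A $$ (i, \<pi> i) = m i * y i ^ a (\<pi> i)" by (simp add: A_def)
      qed
      then show ?thesis
        by (simp only: prod.distrib Suc_eq_plus1[symmetric] lessThan_Suc_atMost)
    qed
    then have "det A = (\<Sum>\<pi> | \<pi> permutes {0..<k + 1}.
        (\<Prod>i\<le>k. m i) * (signof \<pi> * (\<Prod>i<k+1. y i ^ a (\<pi> i))))"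
      unfolding det_def'[OF A]
      by (intro sum.cong refl) (simp only: mem_Collect_eq mult.left_commute)
    then show ?thesis
      unfolding det_generalized_vandermonde sum_distrib_left[symmetric]
      by (simp only: atLeast0LessThan Suc_eq_plus1[symmetric] lessThan_Suc_atMost)
  qed
  finally show ?thesis .
qed

section \<open>The lower bound\<close>

text \<open>For l = 0 this is the constant n, which does occur as an entry of the matrices
  below.\<close>

definition power_sum :: "nat \<Rightarrow> nat \<Rightarrow> 'k::comm_ring_1 mpoly" where
  "power_sum n l = (\<Sum>i<n. Var i ^ l)"

lemma permute_vars_power_sum:
  assumes "\<sigma> permutes {..<n}"
  shows "permute_vars \<sigma> (power_sum n l) = (power_sum n l :: 'k::comm_ring_1 mpoly)"
proof -
  interpret comm_ring_hom "permute_vars \<sigma> :: 'k mpoly \<Rightarrow> _"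
    using assms by (intro permute_vars_hom permutes_bij)
  have "permute_vars \<sigma> (power_sum n l) = (\<Sum>i<n. (Var (\<sigma> i) :: 'k mpoly) ^ l)"
    by (simp add: power_sum_def hom_sum hom_power permute_vars_Var permutes_bij[OF assms])
  also have "\<dots> = power_sum n l"
    unfolding power_sum_def using sum.permute[OF assms, of "\<lambda>i. (Var i :: 'k mpoly) ^ l"]
    by (simp add: o_def)
  finally show ?thesis .
qed

lemma power_sum_sym: "power_sum n l \<in> sym_polys n"
  unfolding sym_polys_def
  by (auto simp: permute_vars_power_sum)
    (auto simp: power_sum_def intro!: polys_in_sum polys_in_power polys_in_Var)

lemma power_sum_homogeneous: "power_sum n l \<in> homogeneous l"
  unfolding power_sum_def
  using homogeneous_power[OF homogeneous_Var, of _ l] by (intro homogeneous_sum) simp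

lemma eval_poly_power_sum: "eval_poly x (power_sum n l) = (\<Sum>i<n. x i ^ l)"
  by (simp add: power_sum_def eval_poly.hom_sum eval_poly.hom_power)

text \<open>By multilinearity in the rows,
  \<open>det (hankel_matrix n k a)\<close> is the sum of $x_{g}^a \det V(x_{g(0)}, \dots, x_{g(k)})$ over all
  maps $g$ from $\{0, \dots, k\}$ to the variables.\<close>

definition hankel_matrix :: "nat \<Rightarrow> nat \<Rightarrow> (nat \<Rightarrow> nat) \<Rightarrow> 'k::comm_ring_1 mpoly mat" where
  "hankel_matrix n k a = mat (k + 1) (k + 1) (\<lambda>(j, l). power_sum n (a j + l))"

text \<open>The staircase k - i plus the partition with c_j columns of length j. Adding i gives part
  i of the diagram, k + c_{i+1} + ... + c_{k+1}. The staircase makes the exponents strictly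
  decreasing; with the column indices 0, ..., k it accounts for the area k (k + 1).\<close>

definition hook_exponents :: "nat \<Rightarrow> (nat \<Rightarrow> nat) \<Rightarrow> nat \<Rightarrow> nat" where
  "hook_exponents k c i = (k - i) + (\<Sum>j=i+1..k+1. c j)"

fun durfee_poly :: "nat \<Rightarrow> nat \<times> (nat \<Rightarrow> nat) \<times> (nat \<Rightarrow> nat) \<Rightarrow> 'k::comm_ring_1 mpoly" where
  "durfee_poly n (k, c, b) =
     det (hankel_matrix n k (hook_exponents k c)) * (\<Prod>j=1..k. power_sum n j ^ b j)"

lemma det_hankel_matrix:
  "det (hankel_matrix n k a) =
    (\<Sum>\<pi> | \<pi> permutes {..k}. signof \<pi> * (\<Prod>j\<le>k. power_sum n (a j + \<pi> j)))"
proof -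
  have carr: "hankel_matrix n k a \<in> carrier_mat (k + 1) (k + 1)"
    by (simp add: hankel_matrix_def)
  have "(\<Prod>i = 0..<k + 1. hankel_matrix n k a $$ (i, \<pi> i)) =
      (\<Prod>j = 0..<k + 1. power_sum n (a j + \<pi> j) :: 'a mpoly)"
    if "\<pi> permutes {0..<k + 1}" for \<pi>
  proof (rule prod.cong[OF refl])
    fix i assume "i \<in> {0..<k + 1}"
    then have "i < k + 1" "\<pi> i < k + 1" using permutes_in_image[OF that, of i] by auto
    then show "hankel_matrix n k a $$ (i, \<pi> i) = (power_sum n (a i + \<pi> i) :: 'a mpoly)"
      by (simp add: hankel_matrix_def)
  qed
  then have "det (hankel_matrix n k a) = (\<Sum>\<pi> | \<pi> permutes {0..<k + 1}.
      signof \<pi> * (\<Prod>j = 0..<k + 1. power_sum n (a j + \<pi> j) :: 'a mpoly))"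
    unfolding det_def'[OF carr] by (intro sum.cong refl) (simp only: mem_Collect_eq)
  then show ?thesis by (simp only: atLeast0LessThan Suc_eq_plus1[symmetric] lessThan_Suc_atMost)
qed

text \<open>Double counting: c_j occurs in the tail sums of the rows 0, ..., j - 1, hence j
  times.\<close>

lemma sum_hook_exponents:
  "(\<Sum>i\<le>k. hook_exponents k c i + i) = k * (k + 1) + (\<Sum>j=1..k+1. j * c j)"
proof -
  have "(\<Sum>i\<le>q. \<Sum>j=i+1..q+1. c j) = (\<Sum>j=1..q+1. j * c j)" for q
  proof (induction q)
    case (Suc q)
    have "(\<Sum>j=i+1..Suc q+1. c j) = (\<Sum>j=i+1..q+1. c j) + c (Suc q + 1)" if "i \<le> Suc q" for i
      using that by simp
    then have "(\<Sum>i\<le>Suc q. \<Sum>j=i+1..Suc q+1. c j) =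
        (\<Sum>i\<le>Suc q. (\<Sum>j=i+1..q+1. c j) + c (Suc q + 1))"
      by (intro sum.cong) auto
    also have "\<dots> = (\<Sum>i\<le>Suc q. \<Sum>j=i+1..q+1. c j) + (Suc q + 1) * c (Suc q + 1)"
      unfolding sum.distrib by simp
    also have "(\<Sum>i\<le>Suc q. \<Sum>j=i+1..q+1. c j) = (\<Sum>i\<le>q. \<Sum>j=i+1..q+1. c j)"
      by simp
    finally show ?case using Suc.IH by simp
  qed simp
  moreover have "(\<Sum>i\<le>k. hook_exponents k c i + i) = (\<Sum>i\<le>k. k + (\<Sum>j=i+1..k+1. c j))"
    by (intro sum.cong) (auto simp: hook_exponents_def)
  ultimately show ?thesis by (simp add: sum.distrib)
qed

lemma durfee_poly_mem:
  assumes "t \<in> durfee_data r d"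
  shows "durfee_poly n t \<in> (sym_polys n \<inter> homogeneous d :: 'k::comm_ring_1 mpoly set)"
proof -
  obtain k c b where t: "t = (k, c, b)" by (cases t)
  let ?a = "hook_exponents k c"
  \<comment> \<open>All terms of the determinant have the same degree, as a permutation does not
    change the sum of the column indices.\<close>
  have deg: "(\<Sum>j\<le>k. ?a j + \<pi> j) = k * (k + 1) + (\<Sum>j=1..k+1. j * c j)"
    if "\<pi> permutes {..k}" for \<pi>
    unfolding sum_hook_exponents[symmetric] sum.distrib
    using sum.permute[OF that, of "\<lambda>i. i"] by (simp add: o_def)
  have "det (hankel_matrix n k ?a) \<in> (homogeneous (k * (k + 1) + (\<Sum>j=1..k+1. j * c j)) :: 'k mpoly set)"
    unfolding det_hankel_matrix
  proof (intro homogeneous_sum homogeneous_signof_mult)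
    fix \<pi> assume "\<pi> \<in> {\<pi>. \<pi> permutes {..k}}"
    then have "\<pi> permutes {..k}" by simp
    then show "(\<Prod>j\<le>k. power_sum n (?a j + \<pi> j)) \<in>
        (homogeneous (k * (k + 1) + (\<Sum>j=1..k+1. j * c j)) :: 'k mpoly set)"
      unfolding deg[OF \<open>\<pi> permutes {..k}\<close>, symmetric]
      by (intro homogeneous_prod power_sum_homogeneous)
  qed
  moreover have "(\<Prod>j=1..k. power_sum n j ^ b j) \<in> (homogeneous (\<Sum>j=1..k. b j * j) :: 'k mpoly set)"
    by (intro homogeneous_prod homogeneous_power power_sum_homogeneous)
  ultimately have "durfee_poly n t \<in> (homogeneous (k * (k + 1) + (\<Sum>j=1..k+1. j * c j) +
      (\<Sum>j=1..k. b j * j)) :: 'k mpoly set)"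
    unfolding t durfee_poly.simps by (rule homogeneous_mult)
  also have "k * (k + 1) + (\<Sum>j=1..k+1. j * c j) + (\<Sum>j=1..k. b j * j) = d"
    using assms by (simp add: t durfee_data_def mult.commute)
  finally have "durfee_poly n t \<in> (homogeneous d :: 'k mpoly set)" .
  moreover have sgn: "signof \<pi> * p \<in> sym_polys n" if "p \<in> sym_polys n" for \<pi> :: "nat \<Rightarrow> nat" and p :: "'k mpoly"
    using that sym_polys_scale[OF that, of "-1"]
    by (cases \<pi> rule: sign_cases) (auto simp: scale_conv_mult single_uminus)
  have "det (hankel_matrix n k ?a) \<in> (sym_polys n :: 'k mpoly set)"
    unfolding det_hankel_matrix by (intro sym_polys_sum sgn sym_polys_prod power_sum_sym)
  then have "durfee_poly n t \<in> (sym_polys n :: 'k mpoly set)"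
    unfolding t durfee_poly.simps
    by (intro sym_polys_mult sym_polys_prod sym_polys_power power_sum_sym)
  ultimately show ?thesis by blast
qed

section \<open>Evaluation at points with few distinct values\<close>

lemma eval_poly_ideal:
  fixes x :: "nat \<Rightarrow> 'k::field_char_0"
  assumes "p \<in> hook_specht_ideal r" "range x \<subseteq> y ` {..k}" "k < r"
  shows "eval_poly x p = 0"
  using assms(1) unfolding hook_specht_ideal_def
proof (induction rule: ideal.span_induct_alt)
  case (step c q q')
  then obtain i where i: "q = det (vandermonde r (\<lambda>j. Var (i j)))" by auto
  \<comment> \<open>Pigeonhole: r + 1 rows draw on at most k + 1 \<le> r values, so two rows
    coincide.\<close>
  have "\<not> inj_on (\<lambda>j. x (i j)) {..r}"
  proof
    assume "inj_on (\<lambda>j. x (i j)) {..r}"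
    then have "card {..r} = card ((\<lambda>j. x (i j)) ` {..r})" by (simp add: card_image)
    also have "\<dots> \<le> card (y ` {..k})" using assms(2) by (intro card_mono) auto
    also have "\<dots> \<le> card {..k}" by (intro card_image_le) simp
    finally show False using assms(3) by simp
  qed
  then obtain j j' where jj: "j \<le> r" "j' \<le> r" "j \<noteq> j'" "x (i j) = x (i j')"
    by (auto simp: inj_on_def)
  have "eval_poly x q = det (vandermonde r (\<lambda>j. x (i j)))"
    by (simp add: i eval_poly.hom_det_vandermonde)
  also have "\<dots> = 0"
    using jj by (intro det_identical_rows[of _ "r + 1" j j'])
      (auto simp: vandermonde_def intro!: eq_vecI)
  finally show ?case using step by (simp add: eval_poly_add eval_poly_mult)
qed simp

lemma ex_point:
  fixes y :: "nat \<Rightarrow> 'k::field"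
  assumes "(\<Sum>i\<le>k. m i) = n"
  obtains x where "range x \<subseteq> y ` {..k}" "\<And>l. (\<Sum>i<n. x i ^ l) = (\<Sum>i\<le>k. of_nat (m i) * y i ^ l)"
proof -
  define zs where "zs = concat (map (\<lambda>j. replicate (m j) (y j)) [0..<Suc k])"
  have len: "length zs = n"
    using assms
    by (simp add: zs_def length_concat o_def interv_sum_list_conv_sum_set_nat atLeast0LessThan
        lessThan_Suc_atMost del: upt_Suc)
  have sub: "set zs \<subseteq> y ` {..k}" by (auto simp: zs_def)
  \<comment> \<open>The value m_i is taken m_i-fold in the sense of \<open>zs\<close>:
    \<open>y i\<close> is listed \<open>m i\<close> times. Variables from n on also get one of these
    values, since the generators of the ideal involve all variables.\<close>
  define x where "x i = (if i < n then zs ! i else y 0)" for i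
  have "range x \<subseteq> y ` {..k}"
    using sub len by (auto simp: x_def)
  moreover have "(\<Sum>i<n. x i ^ l) = (\<Sum>i\<le>k. of_nat (m i) * y i ^ l)" for l
  proof -
    have "(\<Sum>i<n. x i ^ l) = (\<Sum>z\<leftarrow>zs. z ^ l)"
      by (simp add: sum_list_sum_nth len x_def atLeast0LessThan)
    also have "\<dots> = (\<Sum>j\<leftarrow>[0..<Suc k]. of_nat (m j) * y j ^ l)"
    proof -
      have "(\<Sum>z\<leftarrow>concat (map (\<lambda>j. replicate (m j) (y j)) js). z ^ l) =
          (\<Sum>j\<leftarrow>js. of_nat (m j) * y j ^ l)" for js
        by (induction js) (simp_all add: sum_list_replicate)
      then show ?thesis unfolding zs_def .
    qed
    also have "\<dots> = (\<Sum>i\<le>k. of_nat (m i) * y i ^ l)"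
      by (simp add: interv_sum_list_conv_sum_set_nat atLeast0LessThan lessThan_Suc_atMost del: upt_Suc)
    finally show ?thesis .
  qed
  ultimately show ?thesis by (rule that)
qed

lemma permutes_strict_mono_imp_id:
  fixes \<pi> :: "nat \<Rightarrow> nat"
  assumes \<pi>: "\<pi> permutes {..k}" and mono: "\<And>i j. i < j \<Longrightarrow> j \<le> k \<Longrightarrow> \<pi> i < \<pi> j"
  shows "\<pi> = id"
proof -
  have "\<pi> i = i" if "i \<le> k" for i
    using that
  proof (induction i rule: less_induct)
    case (less i)
    obtain i' where i': "\<pi> i' = i" using permutes_surj[OF \<pi>] by (metis surjD)
    have "i' \<le> k" using i' less.prems permutes_in_image[OF \<pi>, of i'] by simp
    have "\<not> i' < i"
    proof
      assume "i' < i"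
      then have "\<pi> i' = i'" using less.prems by (intro less.IH) auto
      then show False using i' \<open>i' < i\<close> by simp
    qed
    moreover have "\<not> i < i'"
    proof
      assume "i < i'"
      then have "\<pi> i < i" using mono[of i i'] i' \<open>i' \<le> k\<close> by simp
      then have "\<pi> (\<pi> i) = \<pi> i" using less by simp
      then have "\<pi> i = i" using permutes_inj[OF \<pi>] by (simp add: inj_eq)
      then show False using \<open>\<pi> i < i\<close> by simp
    qed
    ultimately show ?case using i' by (cases i i' rule: linorder_cases) auto
  qed
  moreover have "\<pi> i = i" if "\<not> i \<le> k" for i
    using \<pi> that by (simp add: permutes_def)
  ultimately show ?thesis by (auto simp: fun_eq_iff)
qed

lemma hook_exponents_less: "i < j \<Longrightarrow> j \<le> k \<Longrightarrow> hook_exponents k c j < hook_exponents k c i"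
proof -
  assume "i < j" "j \<le> k"
  then have "(\<Sum>l=j+1..k+1. c l) \<le> (\<Sum>l=i+1..k+1. c l)" by (intro sum_mono2) auto
  then show ?thesis using \<open>i < j\<close> \<open>j \<le> k\<close> by (simp add: hook_exponents_def)
qed

text \<open>c_j is the difference of two consecutive tail sums; for j = k + 1 the second one is
  empty.\<close>

lemma hook_exponents_inject:
  assumes "\<And>i. i \<le> k \<Longrightarrow> hook_exponents k c i = hook_exponents k c' i"
    and j: "1 \<le> j" "j \<le> k + 1"
  shows "c j = c' j"
proof -
  have eq: "(\<Sum>l=i..k+1. c l) = (\<Sum>l=i..k+1. c' l)" if "1 \<le> i" for i
  proof (cases "i \<le> k + 1")
    case True
    obtain i' where i': "i = i' + 1" using \<open>1 \<le> i\<close> by (metis le_add_diff_inverse2)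
    then have "hook_exponents k c i' = hook_exponents k c' i'" using True by (intro assms(1)) simp
    then show ?thesis by (simp only: hook_exponents_def i' add_left_cancel)
  qed simp
  have "(\<Sum>l=j..k+1. c l) = c j + (\<Sum>l=Suc j..k+1. c l)"
    "(\<Sum>l=j..k+1. c' l) = c' j + (\<Sum>l=Suc j..k+1. c' l)"
    using j by (simp_all only: sum.atLeast_Suc_atMost)
  then show ?thesis using eq[of j] eq[of "Suc j"] j by simp
qed

lemma eval_durfee_poly:
  assumes "\<And>l. (\<Sum>i<n. x i ^ l) = (\<Sum>i\<le>k. m i * y i ^ l)"
  shows "eval_poly x (durfee_poly n (k, c, b)) =
    (\<Prod>i\<le>k. m i) * det (generalized_vandermonde k (hook_exponents k c) y) *
    det (vandermonde k y) * (\<Prod>j=1..k. (\<Sum>i\<le>k. m i * y i ^ j) ^ b j)"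
proof -
  let ?a = "hook_exponents k c"
  have "map_mat (eval_poly x) (hankel_matrix n k ?a) =
      mat (k + 1) (k + 1) (\<lambda>(j, l). \<Sum>i\<le>k. m i * y i ^ (?a j + l))"
    by (rule eq_matI) (auto simp: hankel_matrix_def eval_poly_power_sum assms)
  then have "eval_poly x (det (hankel_matrix n k ?a)) =
      det (mat (k + 1) (k + 1) (\<lambda>(j, l). \<Sum>i\<le>k. m i * y i ^ (?a j + l)))"
    by (metis eval_poly.hom_det)
  then show ?thesis
    by (simp only: durfee_poly.simps det_hankel eval_poly_mult eval_poly.hom_prod
        eval_poly.hom_power eval_poly_power_sum assms)
qed

text \<open>A point with fewer values is read as one with k + 1 values, the surplus ones of
  multiplicity 0; the product of the multiplicities then vanishes.\<close>

lemma eval_durfee_poly_eq_0: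
  fixes x :: "nat \<Rightarrow> 'k::comm_ring_1"
  assumes "\<And>l. (\<Sum>i<n. x i ^ l) = (\<Sum>i\<le>k'. m i * y i ^ l)" and "k' < k"
  shows "eval_poly x (durfee_poly n (k, c, b)) = 0"
proof -
  define m' where "m' i = (if i \<le> k' then m i else 0)" for i
  have "(\<Sum>i<n. x i ^ l) = (\<Sum>i\<le>k. m' i * y i ^ l)" for l
    unfolding assms(1) using assms(2)
    by (intro sum.mono_neutral_cong_left) (auto simp: m'_def)
  note eval = eval_durfee_poly[OF this, of c b]
  have "(\<Prod>i\<le>k. m' i) = 0" using assms(2) by (intro prod_zero bexI[of _ k]) (auto simp: m'_def)
  then show ?thesis unfolding eval by (simp only: mult_zero_left)
qed

section \<open>Linear independence of the Durfee polynomials\<close>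

text \<open>For fixed y the relation extends from positive integer multiplicities to arbitrary
  weights in the field with sum n. These weights realize all values of p_1, ..., p_k, so the
  monomials in the power sums are independent.\<close>

lemma moments_independent:
  fixes y :: "nat \<Rightarrow> 'k::field_char_0" and A :: "'s \<Rightarrow> 'k" and b :: "'s \<Rightarrow> nat \<Rightarrow> nat"
  assumes y: "inj_on y {..k}" and T: "finite T"
    and b: "\<And>t. t \<in> T \<Longrightarrow> (\<Sum>j=1..k. b t j) \<le> d" and n: "k * (d + 1) < n"
    and zero: "\<And>m :: nat \<Rightarrow> nat. (\<Sum>i\<le>k. m i) = n \<Longrightarrow> (\<forall>i\<le>k. m i > 0) \<Longrightarrow>
      (\<Sum>t\<in>T. A t * (\<Prod>j=1..k. (\<Sum>i\<le>k. of_nat (m i) * y i ^ j) ^ b t j)) = 0"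
  shows "(\<Sum>t | t \<in> T \<and> (\<forall>j\<in>{1..k}. b t j = e j). A t) = 0"
proof -
  \<comment> \<open>The power sums with m_0 eliminated through the total n; each is affine in every
    remaining coordinate.\<close>
  define P where "P m j = of_nat n * y 0 ^ j + (\<Sum>i=1..k. m i * (y i ^ j - y 0 ^ j))" for m j
  define F where "F m = (\<Sum>t\<in>T. A t * (\<Prod>j=1..k. P m j ^ b t j))" for m
  \<comment> \<open>Degree at most d requires d + 1 values, and they start at 1 because
    multiplicities must be positive.\<close>
  define S where "S = (of_nat :: nat \<Rightarrow> 'k) ` {1..d+1}"
  have split: "{..k} = insert 0 {1..k}" by auto
  have P: "P m j = (\<Sum>i\<le>k. m i * y i ^ j)" if "(\<Sum>i\<le>k. m i) = of_nat n" for m j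
  proof -
    have "of_nat n = m 0 + (\<Sum>i=1..k. m i)" unfolding that[symmetric] split by simp
    moreover have "(\<Sum>i\<le>k. m i * y i ^ j) = m 0 * y 0 ^ j + (\<Sum>i=1..k. m i * y i ^ j)"
      unfolding split by simp
    ultimately show ?thesis
      unfolding P_def by (simp add: right_diff_distrib sum_subtractf distrib_right sum_distrib_right)
  qed
  have "F m = 0" for m
  proof (rule vanishing_on_grid[where F = F and m = m and J = "{1..k}" and D = d and S = S])
    show "poly_fun d (\<lambda>t. F (m(i := t)))" if i: "i \<in> {1..k}" for m i
    proof -
      have "poly_fun 1 (\<lambda>t. P (m(i := t)) j)" for j
      proof -
        have "(\<Sum>l\<in>{1..k}. (m(i := t)) l * (y l ^ j - y 0 ^ j)) = t * (y i ^ j - y 0 ^ j) +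
            (\<Sum>l\<in>{1..k} - {i}. m l * (y l ^ j - y 0 ^ j))" for t
          using i by (subst sum.remove[of _ i]) (auto intro!: sum.cong)
        then have "P (m(i := t)) j = (of_nat n * y 0 ^ j +
            (\<Sum>l\<in>{1..k} - {i}. m l * (y l ^ j - y 0 ^ j))) + t * (y i ^ j - y 0 ^ j)" for t
          by (simp only: P_def ac_simps)
        then show ?thesis by (simp only: poly_fun_affine)
      qed
      then have "poly_fun (b t j * 1) (\<lambda>s. P (m(i := s)) j ^ b t j)" for t j
        by (rule poly_fun_power)
      then have "poly_fun (\<Sum>j=1..k. b t j * 1) (\<lambda>s. \<Prod>j=1..k. P (m(i := s)) j ^ b t j)" for t
        by (intro poly_fun_prod) auto
      then have "poly_fun d (\<lambda>s. \<Prod>j=1..k. P (m(i := s)) j ^ b t j)" if "t \<in> T" for t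
        by (rule poly_fun_mono) (simp only: mult_1_right b[OF that])
      then have "poly_fun (0 + d) (\<lambda>s. A t * (\<Prod>j=1..k. P (m(i := s)) j ^ b t j))" if "t \<in> T" for t
        using that by (intro poly_fun_mult poly_fun_const)
      then show ?thesis unfolding F_def using T by (intro poly_fun_sum) auto
    qed
    show "card S > d"
      unfolding S_def by (subst card_image) (auto simp: inj_on_def)
    show "F m = 0" if m: "\<forall>i\<in>{1..k}. m i \<in> S" for m
    proof -
      have "\<forall>i\<in>{1..k}. \<exists>q. m i = of_nat q \<and> q \<in> {1..d+1}" using m unfolding S_def by blast
      from bchoice[OF this] obtain \<mu> where
        \<mu>: "\<And>i. i \<in> {1..k} \<Longrightarrow> m i = of_nat (\<mu> i)" "\<And>i. i \<in> {1..k} \<Longrightarrow> \<mu> i \<in> {1..d+1}"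
        by blast
      \<comment> \<open>The value \<open>y 0\<close> receives all remaining variables; k (d + 1) < n
        keeps its multiplicity positive.\<close>
      define \<mu>' where "\<mu>' i = (if i = 0 then n - (\<Sum>i=1..k. \<mu> i) else \<mu> i)" for i
      have "(\<Sum>i=1..k. \<mu> i) \<le> (\<Sum>i=1..k. d + 1)" using \<mu>(2) by (intro sum_mono) auto
      then have lt: "(\<Sum>i=1..k. \<mu> i) < n" using n by simp
      have eq: "(\<Sum>i=1..k. \<mu>' i) = (\<Sum>i=1..k. \<mu> i)" by (intro sum.cong) (auto simp: \<mu>'_def)
      have sum: "(\<Sum>i\<le>k. \<mu>' i) = n" unfolding split using lt eq by (simp add: \<mu>'_def)
      then have sum': "(\<Sum>i\<le>k. of_nat (\<mu>' i)) = (of_nat n :: 'k)" by (metis of_nat_sum)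
      have "P m j = P (\<lambda>i. of_nat (\<mu>' i)) j" for j
        unfolding P_def using \<mu>(1) by (auto simp: \<mu>'_def intro!: sum.cong)
      also have "P (\<lambda>i. of_nat (\<mu>' i)) j = (\<Sum>i\<le>k. of_nat (\<mu>' i) * y i ^ j)" for j
        by (rule P[OF sum'])
      finally have Pm: "P m j = (\<Sum>i\<le>k. of_nat (\<mu>' i) * y i ^ j)" for j .
      have "\<forall>i\<le>k. \<mu>' i > 0"
        using \<mu>(2) lt by (auto simp: \<mu>'_def Suc_le_eq)
      from zero[OF sum this] show ?thesis unfolding F_def Pm .
    qed
  qed (simp_all add: S_def)
  then have "(\<Sum>t\<in>T. A t * (\<Prod>i<k. x i ^ b t (Suc i))) = 0" for x
  proof -
    \<comment> \<open>Moment 0 is prescribed as n, so that \<open>P\<close> computes the moments;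
      moment j is the free coordinate x (j - 1).\<close>
    obtain m where m: "\<And>l. l \<le> k \<Longrightarrow> (\<Sum>i\<le>k. m i * y i ^ l) = (if l = 0 then of_nat n else x (l - 1))"
      using solve_moments[OF y, of "\<lambda>l. if l = 0 then of_nat n else x (l - 1)"] by blast
    have "(\<Sum>i\<le>k. m i) = of_nat n" using m[of 0] by simp
    from P[OF this] have "P m (Suc i) = x i" if "i < k" for i
      using m[of "Suc i"] that by simp
    then have "(\<Prod>j=1..k. P m j ^ b t j) = (\<Prod>i<k. x i ^ b t (Suc i))" for t
      by (simp add: prod.atLeast1_atMost_eq)
    then show ?thesis using \<open>\<And>m. F m = 0\<close>[of m] by (simp only: F_def)
  qed
  from monomial_functions_independent[OF T this, of "\<lambda>i. e (Suc i)"]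
  have "(\<Sum>t | t \<in> T \<and> (\<forall>i<k. b t (Suc i) = e (Suc i)). A t) = 0" .
  moreover have "(\<forall>i<k. b t (Suc i) = e (Suc i)) \<longleftrightarrow> (\<forall>j\<in>{1..k}. b t j = e j)" for t
    by (auto simp: Suc_le_eq) (metis Suc_le_eq Suc_pred)
  ultimately show ?thesis by (simp only:)
qed

text \<open>In the expanded sum the monomial with exponents \<open>a t\<close> comes only from t and
  the identity permutation, because all \<open>a s\<close> are strictly decreasing and
  distinct.\<close>

lemma generalized_vandermonde_independent:
  fixes g :: "'s \<Rightarrow> 'k::field_char_0"
  assumes T: "finite T"
    and zero: "\<And>y. inj_on y {..k} \<Longrightarrow> (\<Sum>t\<in>T. g t * det (generalized_vandermonde k (a t) y)) = 0"
    and a: "\<And>t i j. t \<in> T \<Longrightarrow> i < j \<Longrightarrow> j \<le> k \<Longrightarrow> a t j < a t i"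
    and inj: "\<And>s t. s \<in> T \<Longrightarrow> t \<in> T \<Longrightarrow> (\<And>i. i \<le> k \<Longrightarrow> a s i = a t i) \<Longrightarrow> s = t"
    and t: "t \<in> T"
  shows "g t = 0"
proof -
  let ?S = "T \<times> {\<pi>. \<pi> permutes {..k}}"
  have "(\<Sum>s\<in>?S. (g (fst s) * signof (snd s)) * (\<Prod>i<k+1. y i ^ a (fst s) (snd s i))) = 0" for y
  proof -
    have "(\<Sum>s\<in>?S. (g (fst s) * signof (snd s)) * (\<Prod>i<k+1. y i ^ a (fst s) (snd s i))) =
        (\<Sum>t\<in>T. g t * det (generalized_vandermonde k (a t) y))"
      unfolding det_generalized_vandermonde sum_distrib_left
      by (subst sum.cartesian_product) (simp only: case_prod_unfold mult.assoc)
    also have "\<dots> = 0"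
    \<comment> \<open>Alternants vanish when two values agree, so the relation holds at every point,
      as the independence of monomials requires.\<close>
    proof (cases "inj_on y {..k}")
      case False
      then show ?thesis by (simp add: det_generalized_vandermonde_eq_0)
    qed (rule zero)
    finally show ?thesis .
  qed
  from monomial_functions_independent[OF _ this, of "a t"] T
  have "(\<Sum>s | s \<in> ?S \<and> (\<forall>i<k+1. a (fst s) (snd s i) = a t i). g (fst s) * signof (snd s)) = 0"
    by (simp add: finite_permutations)
  also have "{s. s \<in> ?S \<and> (\<forall>i<k+1. a (fst s) (snd s i) = a t i)} = {(t, id)}"
  proof (intro equalityI subsetI)
    fix s assume "s \<in> {s. s \<in> ?S \<and> (\<forall>i<k+1. a (fst s) (snd s i) = a t i)}"
    then obtain t' \<pi> where s: "s = (t', \<pi>)" "t' \<in> T" "\<pi> permutes {..k}"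
        "\<And>i. i \<le> k \<Longrightarrow> a t' (\<pi> i) = a t i"
      by (cases s) (auto simp: less_Suc_eq_le)
    have "\<pi> = id"
    proof (rule permutes_strict_mono_imp_id[OF s(3)])
      fix i j :: nat assume ij: "i < j" "j \<le> k"
      have "a t' (\<pi> j) < a t' (\<pi> i)" using s(4)[of i] s(4)[of j] ij a[OF t ij] by simp
      moreover have "\<pi> i \<le> k" using permutes_in_image[OF s(3), of i] ij by simp
      ultimately show "\<pi> i < \<pi> j"
        using a[OF s(2), of "\<pi> j" "\<pi> i"] by (cases "\<pi> i" "\<pi> j" rule: linorder_cases) auto
    qed
    moreover from this have "t' = t" using inj[OF s(2) t] s(4) by simp
    ultimately show "s \<in> {(t, id)}" by (simp add: s(1))
  qed (use t permutes_id in auto)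
  finally show ?thesis by simp
qed

text \<open>Induction on the rectangle size k with evaluation at points with k + 1 distinct values.
  For fixed values the power sums first separate the lower parts \<open>b\<close>; then varying the
  values separates the right parts \<open>c\<close>.\<close>

lemma durfee_poly_independent:
  fixes g :: "_ \<Rightarrow> 'k::field_char_0" and r d :: nat
  defines "T \<equiv> durfee_data r d"
  assumes fin: "finite T" and n: "r * (d + 1) < n"
    and mem: "(\<Sum>t\<in>T. scale (g t) (durfee_poly n t)) \<in> hook_specht_ideal r"
  shows "\<forall>t\<in>T. g t = 0"
proof -
  have "\<forall>t\<in>T. fst t = k \<longrightarrow> g t = 0" for k
  proof (induction k rule: less_induct)
    case (less k)
    show ?case
    proof (cases "k < r")
      case False
      then show ?thesis by (auto simp: T_def durfee_data_def)
    next
      case True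
      define U where "U = {t \<in> T. fst t = k}"
      define det' where "det' y t = det (generalized_vandermonde k (hook_exponents k (fst (snd t))) y)"
        for y :: "nat \<Rightarrow> 'k" and t :: "nat \<times> (nat \<Rightarrow> nat) \<times> (nat \<Rightarrow> nat)"
      have U: "finite U" using fin by (simp add: U_def)
      have "k * (d + 1) \<le> r * (d + 1)" using True by (intro mult_right_mono) auto
      then have kn: "k * (d + 1) < n" using n by linarith
      have ev: "(\<Sum>t\<in>U. (g t * det' y t) * (\<Prod>j=1..k. (\<Sum>i\<le>k. of_nat (m i) * y i ^ j) ^ snd (snd t) j)) = 0"
        if y: "inj_on y {..k}" and m: "(\<Sum>i\<le>k. m i) = n" "\<forall>i\<le>k. m i > 0" for y m
      proof -
        obtain x where x: "range x \<subseteq> y ` {..k}"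
            "\<And>l. (\<Sum>i<n. x i ^ l) = (\<Sum>i\<le>k. of_nat (m i) * y i ^ l)"
          using ex_point[OF m(1), of y] by blast
        \<comment> \<open>The factor common to all data of size k; it is nonzero since the
          multiplicities are positive and the values distinct.\<close>
        define C where "C = (\<Prod>i\<le>k. of_nat (m i)) * det (vandermonde k y)"
        let ?P = "\<lambda>t. \<Prod>j=1..k. (\<Sum>i\<le>k. of_nat (m i) * y i ^ j) ^ snd (snd t) j"
        have "C \<noteq> 0" using m(2) det_vandermonde_nonzero[OF y] by (simp add: C_def)
        have "0 = eval_poly x (\<Sum>t\<in>T. scale (g t) (durfee_poly n t))"
          by (rule eval_poly_ideal[OF mem x(1) True, symmetric])
        also have "\<dots> = (\<Sum>t\<in>T. g t * eval_poly x (durfee_poly n t))"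
          by (simp add: eval_poly.hom_sum eval_poly_scale)
        \<comment> \<open>Smaller rectangles have coefficient 0 by induction, larger ones vanish at
          the point.\<close>
        also have "\<dots> = (\<Sum>t\<in>U. g t * eval_poly x (durfee_poly n t))"
        proof (rule sum.mono_neutral_right)
          show "\<forall>t\<in>T - U. g t * eval_poly x (durfee_poly n t) = 0"
          proof
            fix t assume t: "t \<in> T - U"
            obtain k' c b where t': "t = (k', c, b)" by (cases t)
            consider "k' < k" | "k < k'" using t by (auto simp: U_def t' linorder_neq_iff)
            then show "g t * eval_poly x (durfee_poly n t) = 0"
            proof cases
              case 1
              then have "g t = 0" using less.IH[of k'] t by (auto simp: t')
              then show ?thesis by simp
            next
              case 2
              then show ?thesis using eval_durfee_poly_eq_0[OF x(2)] by (simp add: t' del: durfee_poly.simps)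
            qed
          qed
        qed (use fin in \<open>auto simp: U_def\<close>)
        also have "\<dots> = (\<Sum>t\<in>U. C * ((g t * det' y t) * ?P t))"
        proof (rule sum.cong[OF refl])
          fix t assume "t \<in> U"
          then obtain c b where t: "t = (k, c, b)" by (cases t) (auto simp: U_def)
          show "g t * eval_poly x (durfee_poly n t) = C * ((g t * det' y t) * ?P t)"
            unfolding t eval_durfee_poly[OF x(2)] det'_def C_def fst_conv snd_conv
            by (simp only: mult_ac)
        qed
        also have "\<dots> = C * (\<Sum>t\<in>U. (g t * det' y t) * ?P t)"
          by (simp only: sum_distrib_left)
        finally show ?thesis using \<open>C \<noteq> 0\<close> by simp
      qed
      have bd: "(\<Sum>j=1..k. snd (snd t) j) \<le> d" if "t \<in> U" for t
      proof -
        have "(\<Sum>j=1..k. snd (snd t) j) \<le> (\<Sum>j=1..k. j * snd (snd t) j)" by (intro sum_mono) auto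
        also have "\<dots> \<le> d" using that by (auto simp: U_def T_def durfee_data_def)
        finally show ?thesis .
      qed
      have "g t = 0" if t: "t \<in> U" for t
      proof -
        \<comment> \<open>The data with the same lower part as \<open>t\<close>; what is left is a
          relation between alternants valid for all distinct values.\<close>
        define V where "V = {s. s \<in> U \<and> (\<forall>j\<in>{1..k}. snd (snd s) j = snd (snd t) j)}"
        have zero: "(\<Sum>s\<in>V. g s * det' y s) = 0" if "inj_on y {..k}" for y
          unfolding V_def
          by (rule moments_independent[where b = "\<lambda>s. snd (snd s)", OF that U bd kn ev[OF that]])
        show ?thesis
        proof (rule generalized_vandermonde_independent[where T = V and k = k and g = g and t = t
              and a = "\<lambda>s. hook_exponents k (fst (snd s))"])
          show "(\<Sum>s\<in>V. g s * det (generalized_vandermonde k (hook_exponents k (fst (snd s))) y)) = 0"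
            if "inj_on y {..k}" for y
            using zero[OF that] unfolding det'_def .
        next
          fix s s' assume s: "s \<in> V" "s' \<in> V"
            "\<And>i. i \<le> k \<Longrightarrow> hook_exponents k (fst (snd s)) i = hook_exponents k (fst (snd s')) i"
          obtain c b c' b' where s': "s = (k, c, b)" "s' = (k, c', b')"
            using s(1,2) by (cases s, cases s') (auto simp: V_def U_def)
          have "c j = c' j" if "j \<in> {1..k+1}" for j
            using hook_exponents_inject[of k c c' j] s(3) that by (simp add: s')
          moreover have "c j = c' j" if "j \<notin> {1..k+1}" for j
            using s(1,2) that by (auto simp: V_def U_def T_def durfee_data_def s')
          moreover have "b j = b' j" for j
            using s(1,2) by (cases "j \<in> {1..k}") (auto simp: V_def U_def T_def durfee_data_def s')
          ultimately show "s = s'" by (auto simp: s' fun_eq_iff)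
        qed (use U t in \<open>auto simp: V_def intro: hook_exponents_less\<close>)
      qed
      then show ?thesis by (auto simp: U_def)
    qed
  qed
  then show ?thesis by blast
qed

section \<open>Counting\<close>

definition weighted_vectors :: "'j set \<Rightarrow> ('j \<Rightarrow> nat) \<Rightarrow> nat \<Rightarrow> ('j \<Rightarrow> nat) set" where
  "weighted_vectors J w d = {c. (\<forall>j. j \<notin> J \<longrightarrow> c j = 0) \<and> (\<Sum>j\<in>J. w j * c j) = d}"

text \<open>The geometric series \<open>g\<close> is characterized by g = 1 + X^w g.\<close>

lemma inverse_one_minus_X_power_nth:
  assumes "w > 0"
  shows "fps_nth (inverse (1 - fps_X ^ w :: 'a::field fps)) i = (if w dvd i then 1 else 0)"
proof -
  define g :: "'a fps" where "g = Abs_fps (\<lambda>i. if w dvd i then 1 else 0)"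
  have "g = 1 + fps_X ^ w * g"
  proof (rule fps_ext)
    fix i
    show "fps_nth g i = fps_nth (1 + fps_X ^ w * g) i"
      using assms by (cases "i < w") (auto simp: g_def fps_X_power_mult_nth dvd_minus_self dest: dvd_imp_le)
  qed
  then have "g * (1 - fps_X ^ w) = 1" by (simp add: algebra_simps)
  then have "inverse (1 - fps_X ^ w) = g"
    by (intro fps_inverse_unique) (simp add: mult.commute)
  then show ?thesis by (simp add: g_def)
qed

text \<open>The component i is the contribution \<open>w j * c j\<close> of the new index, which
  becomes the summation index of the Cauchy product.\<close>

lemma weighted_vectors_insert:
  assumes J: "finite J" "j \<notin> J" and w: "w j > 0"
  shows "bij_betw (\<lambda>(i, c). c(j := i div w j))
    (SIGMA i:{i\<in>{0..d}. w j dvd i}. weighted_vectors J w (d - i))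
    (weighted_vectors (insert j J) w d)"
proof (rule bij_betw_byWitness[where f' = "\<lambda>c. (w j * c j, c(j := 0))"])
  have sum: "(\<Sum>l\<in>J. w l * (c(j := a)) l) = (\<Sum>l\<in>J. w l * c l)" for c a
    using J by (intro sum.cong) auto
  show "\<forall>p\<in>SIGMA i:{i\<in>{0..d}. w j dvd i}. weighted_vectors J w (d - i).
      (w j * (case p of (i, c) \<Rightarrow> c(j := i div w j)) j,
        (case p of (i, c) \<Rightarrow> c(j := i div w j))(j := 0)) = p"
    using J by (auto simp: weighted_vectors_def fun_eq_iff)
  show "\<forall>c\<in>weighted_vectors (insert j J) w d.
      (case (w j * c j, c(j := 0)) of (i, c) \<Rightarrow> c(j := i div w j)) = c"
    using w by auto
  show "(\<lambda>(i, c). c(j := i div w j)) ` (SIGMA i:{i\<in>{0..d}. w j dvd i}. weighted_vectors J w (d - i))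
      \<subseteq> weighted_vectors (insert j J) w d"
    using J by (auto simp: weighted_vectors_def sum simp del: fun_upd_apply) auto
  show "(\<lambda>c. (w j * c j, c(j := 0))) ` weighted_vectors (insert j J) w d
      \<subseteq> (SIGMA i:{i\<in>{0..d}. w j dvd i}. weighted_vectors J w (d - i))"
    using J by (auto simp: weighted_vectors_def sum simp del: fun_upd_apply) auto
qed

lemma weighted_vectors_count:
  assumes "finite J" "\<And>j. j \<in> J \<Longrightarrow> w j > 0"
  shows "finite (weighted_vectors J w d) \<and>
    fps_nth (\<Prod>j\<in>J. inverse (1 - fps_X ^ w j :: rat fps)) d = of_nat (card (weighted_vectors J w d))"
  using assms
proof (induction J arbitrary: d rule: finite_induct)
  case empty
  have "weighted_vectors {} w d = (if d = 0 then {\<lambda>_. 0} else {})"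
    by (auto simp: weighted_vectors_def fun_eq_iff)
  then show ?case by simp
next
  case (insert j J)
  let ?S = "SIGMA i:{i\<in>{0..d}. w j dvd i}. weighted_vectors J w (d - i)"
  have IH: "finite (weighted_vectors J w e)"
    "fps_nth (\<Prod>j\<in>J. inverse (1 - fps_X ^ w j :: rat fps)) e = of_nat (card (weighted_vectors J w e))" for e
    using insert by auto
  have bij: "bij_betw (\<lambda>(i, c). c(j := i div w j)) ?S (weighted_vectors (insert j J) w d)"
    using insert by (intro weighted_vectors_insert) auto
  have "fps_nth (\<Prod>j\<in>insert j J. inverse (1 - fps_X ^ w j :: rat fps)) d =
      (\<Sum>i=0..d. (if w j dvd i then 1 else 0) * of_nat (card (weighted_vectors J w (d - i))))"
    using insert.hyps insert.prems[of j]
    by (simp add: fps_mult_nth inverse_one_minus_X_power_nth IH)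
  also have "\<dots> = (\<Sum>i | i \<in> {0..d} \<and> w j dvd i. of_nat (card (weighted_vectors J w (d - i))))"
    by (subst sum.inter_filter) (auto intro!: sum.cong)
  also have "\<dots> = of_nat (card ?S)"
    using IH(1) by (simp add: card_SigmaI)
  also have "card ?S = card (weighted_vectors (insert j J) w d)"
    using bij by (rule bij_betw_same_card)
  finally have "fps_nth (\<Prod>j\<in>insert j J. inverse (1 - fps_X ^ w j :: rat fps)) d =
      of_nat (card (weighted_vectors (insert j J) w d))" .
  moreover have "finite ?S" using IH(1) by (intro finite_SigmaI) auto
  then have "finite (weighted_vectors (insert j J) w d)"
    using bij_betw_finite[OF bij] by simp
  ultimately show ?case by simp
qed

text \<open>The disjoint sum merges the two multiplicity functions into one vector, with weight
  \<open>case_sum id id\<close>, so a single counting lemma covers both.\<close>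

definition durfee_indices :: "nat \<Rightarrow> (nat + nat) set" where
  "durfee_indices k = {1..k+1} <+> {1..k}"

lemma sum_durfee_indices:
  "(\<Sum>j\<in>durfee_indices k. f j) = (\<Sum>j=1..k+1. f (Inl j)) + (\<Sum>j=1..k. f (Inr j))"
  by (simp only: durfee_indices_def sum.Plus finite_atLeastAtMost o_def)

lemma prod_durfee_indices:
  "(\<Prod>j\<in>durfee_indices k. f j) = (\<Prod>j=1..k+1. f (Inl j)) * (\<Prod>j=1..k. f (Inr j))"
  by (simp only: durfee_indices_def prod.Plus finite_atLeastAtMost o_def)

lemma in_durfee_indices:
  "Inl j \<in> durfee_indices k \<longleftrightarrow> j \<in> {1..k+1}" "Inr j \<in> durfee_indices k \<longleftrightarrow> j \<in> {1..k}"
  by (auto simp: durfee_indices_def)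

lemma durfee_data_conv:
  "bij_betw (\<lambda>(k, s). (k, s \<circ> Inl, s \<circ> Inr))
    (SIGMA k:{k\<in>{..<r}. k * (k + 1) \<le> d}.
      weighted_vectors (durfee_indices k) (case_sum id id) (d - k * (k + 1)))
    (durfee_data r d)"
proof (rule bij_betw_byWitness[where f' = "\<lambda>(k, c, b). (k, case_sum c b)"])
  let ?S = "SIGMA k:{k\<in>{..<r}. k * (k + 1) \<le> d}.
      weighted_vectors (durfee_indices k) (case_sum id id) (d - k * (k + 1))"
  show "\<forall>p\<in>?S. (case case p of (k, s) \<Rightarrow> (k, s \<circ> Inl, s \<circ> Inr) of (k, c, b) \<Rightarrow> (k, case_sum c b)) = p"
    by (auto simp: case_sum_o_inj surjective_sum fun_eq_iff split: sum.split)
  show "\<forall>p\<in>durfee_data r d. (case case p of (k, c, b) \<Rightarrow> (k, case_sum c b) of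
      (k, s) \<Rightarrow> (k, s \<circ> Inl, s \<circ> Inr)) = p"
    by (auto simp: case_sum_o_inj)
  show "(\<lambda>(k, s). (k, s \<circ> Inl, s \<circ> Inr)) ` ?S \<subseteq> durfee_data r d"
    unfolding weighted_vectors_def sum_durfee_indices
    by (auto simp: durfee_data_def split_sum_all in_durfee_indices simp del: sum.cl_ivl_Suc)
  show "(\<lambda>(k, c, b). (k, case_sum c b)) ` durfee_data r d \<subseteq> ?S"
    unfolding weighted_vectors_def sum_durfee_indices
    by (auto simp: durfee_data_def split_sum_all in_durfee_indices simp del: sum.cl_ivl_Suc)
qed

text \<open>The area of the rectangle gives the power of \<open>fps_X\<close>; the two products
  count the parts to the right of it and below it.\<close>

lemma card_durfee_data:
  "finite (durfee_data r d)"
  "of_nat (card (durfee_data r d)) = fps_nth (\<Sum>k<r. fps_X ^ (k * (k + 1)) *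
    ((\<Prod>j=1..k+1. inverse (1 - fps_X ^ j)) * (\<Prod>j=1..k. inverse (1 - fps_X ^ j))) :: rat fps) d"
proof -
  let ?W = "\<lambda>k. weighted_vectors (durfee_indices k) (case_sum id id)"
  let ?S = "SIGMA k:{k\<in>{..<r}. k * (k + 1) \<le> d}. ?W k (d - k * (k + 1))"
  have W: "finite (?W k e)"
    "of_nat (card (?W k e)) = fps_nth ((\<Prod>j=1..k+1. inverse (1 - fps_X ^ j)) *
      (\<Prod>j=1..k. inverse (1 - fps_X ^ j)) :: rat fps) e" for k e
  proof -
    have fin: "finite (durfee_indices k)" by (simp add: durfee_indices_def)
    have pos: "0 < case_sum id id j" if "j \<in> durfee_indices k" for j :: "nat + nat"
      using that by (cases j) (auto simp: in_durfee_indices)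
    show "finite (?W k e)" using weighted_vectors_count[OF fin pos] by simp
    have "fps_nth (\<Prod>j\<in>durfee_indices k. inverse (1 - fps_X ^ case_sum id id j :: rat fps)) e =
        of_nat (card (?W k e))"
      using weighted_vectors_count[OF fin pos] by simp
    then show "of_nat (card (?W k e)) = fps_nth ((\<Prod>j=1..k+1. inverse (1 - fps_X ^ j)) *
        (\<Prod>j=1..k. inverse (1 - fps_X ^ j)) :: rat fps) e"
      unfolding prod_durfee_indices by (simp only: sum.case id_apply)
  qed
  have "finite ?S" using W(1) by (intro finite_SigmaI) auto
  then show "finite (durfee_data r d)" using bij_betw_finite[OF durfee_data_conv] by simp
  have "card (durfee_data r d) = card ?S" by (rule bij_betw_same_card[OF durfee_data_conv, symmetric])
  then have "of_nat (card (durfee_data r d)) =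
      (\<Sum>k | k \<in> {..<r} \<and> k * (k + 1) \<le> d. of_nat (card (?W k (d - k * (k + 1)))) :: rat)"
    using W(1) by (simp add: card_SigmaI)
  also have "\<dots> = (\<Sum>k<r. fps_nth (fps_X ^ (k * (k + 1)) * ((\<Prod>j=1..k+1. inverse (1 - fps_X ^ j)) *
      (\<Prod>j=1..k. inverse (1 - fps_X ^ j)))) d)"
    unfolding W(2) fps_X_power_mult_nth
    by (subst sum.inter_filter) (auto intro!: sum.cong)
  finally show "of_nat (card (durfee_data r d)) = fps_nth (\<Sum>k<r. fps_X ^ (k * (k + 1)) *
    ((\<Prod>j=1..k+1. inverse (1 - fps_X ^ j)) * (\<Prod>j=1..k. inverse (1 - fps_X ^ j))) :: rat fps) d"
    by (simp only: fps_sum_nth)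
qed

text \<open>The exponents 2 i for i \<le> k add up to k (k + 1), and the factor 1 / (1 - t) supplies
  the term j = 1 missing from the product of the 1 / (1 - t^(i+1)).\<close>

lemma hilbert_series_summand:
  "1 / (1 - fps_X) * (\<Prod>i=1..k. fps_X ^ (2 * i) / ((1 - fps_X ^ i) * (1 - fps_X ^ (i + 1)))) =
    (fps_X ^ (k * (k + 1)) * ((\<Prod>j=1..k+1. inverse (1 - fps_X ^ j)) *
      (\<Prod>j=1..k. inverse (1 - fps_X ^ j))) :: rat fps)"
proof (induction k)
  case 0
  then show ?case by (simp add: fps_divide_unit)
next
  case (Suc k)
  have nz: "fps_nth ((1 - fps_X ^ Suc k) * (1 - fps_X ^ (Suc k + 1)) :: rat fps) 0 \<noteq> 0"
    by (simp add: fps_mult_nth_0)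
  have step: "fps_X ^ (2 * Suc k) / ((1 - fps_X ^ Suc k) * (1 - fps_X ^ (Suc k + 1))) =
      (fps_X ^ (2 * Suc k) * (inverse (1 - fps_X ^ Suc k) * inverse (1 - fps_X ^ (Suc k + 1))) :: rat fps)"
    by (simp only: fps_divide_unit[OF nz] fps_inverse_mult)
  have X: "fps_X ^ (Suc k * (Suc k + 1)) = (fps_X ^ (k * (k + 1)) * fps_X ^ (2 * Suc k) :: rat fps)"
  proof -
    have "Suc k * (Suc k + 1) = k * (k + 1) + 2 * Suc k" by simp
    then show ?thesis by (simp only: power_add)
  qed
  have prod1: "(\<Prod>j=1..Suc k. f j) = (\<Prod>j=1..k. f j) * f (Suc k)" for f :: "nat \<Rightarrow> rat fps"
    by simp
  have prod2: "(\<Prod>j=1..Suc k + 1. f j) = (\<Prod>j=1..k+1. f j) * f (Suc k + 1)" for f :: "nat \<Rightarrow> rat fps"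
    by simp
  show ?case
    unfolding prod1 prod2 step X mult.assoc[symmetric] Suc.IH
    by (simp only: mult_ac)
qed

theorem theorem4p1:
  fixes r :: nat
  shows "symmetric_hilbert_series (hook_specht_ideal r :: 'k::field_char_0 mpoly set) =
    1 / (1 - fps_X) *
      (\<Sum>k<r. \<Prod>i=1..k. fps_X ^ (2 * i) / ((1 - fps_X ^ i) * (1 - fps_X ^ (i + 1))))"
proof -
  let ?I = "hook_specht_ideal r :: 'k mpoly set"
  \<comment> \<open>The bound implies both r < n, for the spanning set, and r (d + 1) < n, for
    independence.\<close>
  have dim: "vectorspace.dim class_ring (sym_quotient_component ?I n d) = card (durfee_data r d)"
    if n: "r + r * (d + 1) < n" for n d
  proof -
    interpret mpoly_subspaces "sym_polys n \<inter> homogeneous d" "?I \<inter> sym_polys n"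
      by unfold_locales
        (auto intro: sym_polys_add sym_polys_scale homogeneous_add homogeneous_scale
          ideal_add ideal_zero ideal_scale)
    obtain B :: "'k mpoly set" where B: "finite B" "B \<subseteq> sym_polys n \<inter> homogeneous d"
        "card B \<le> card (durfee_data r d)"
        "\<And>u. u \<in> sym_polys n \<inter> homogeneous d \<Longrightarrow>
          \<exists>c. u - (\<Sum>b\<in>B. scale (c b) b) \<in> ?I \<inter> sym_polys n"
      using n by (rule_tac spanning_set[of r n d]) (auto simp: card_durfee_data(1))
    show ?thesis
      unfolding sym_quotient_component_def
    proof (rule dim_coset_space[OF B(1,2,4) card_durfee_data(1) durfee_poly_mem _ B(3)])
      fix c :: "nat \<times> (nat \<Rightarrow> nat) \<times> (nat \<Rightarrow> nat) \<Rightarrow> 'k"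
      assume "(\<Sum>t\<in>durfee_data r d. scale (c t) (durfee_poly n t)) \<in> ?I \<inter> sym_polys n"
      then show "\<forall>t\<in>durfee_data r d. c t = 0"
        using n durfee_poly_independent[where n = n, OF card_durfee_data(1), of r d c] by simp
    qed
  qed
  have "symmetric_dimension ?I d = card (durfee_data r d)" for d
  proof -
    \<comment> \<open>The sequence is eventually constant, so its limit is the common value.\<close>
    have "\<forall>\<^sub>F n in sequentially.
        vectorspace.dim class_ring (sym_quotient_component ?I n d) = card (durfee_data r d)"
      using eventually_gt_at_top[of "r + r * (d + 1)"] by eventually_elim (rule dim)
    then show ?thesis
      unfolding symmetric_dimension_def by (intro limI tendsto_eventually)
  qed
  then have "symmetric_hilbert_series ?I = (\<Sum>k<r. fps_X ^ (k * (k + 1)) *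
    ((\<Prod>j=1..k+1. inverse (1 - fps_X ^ j)) * (\<Prod>j=1..k. inverse (1 - fps_X ^ j))))"
    by (intro fps_ext) (simp only: symmetric_hilbert_series_def fps_nth_Abs_fps card_durfee_data(2))
  then show ?thesis
    by (simp only: sum_distrib_left hilbert_series_summand)
qed

end
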